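(* Let $(L,[p])$ be a finite-dimensional nilpotent restricted Lie algebra over a field of characteristic $p>0$ that is not a torus. Then $L$ has an outer restricted derivation.
   Context: A restricted Lie algebra $(L,[p])$ over a field of characteristic $p>0$ is a Lie algebra with a $p$-mapping $x\mapsto x^{[p]}$. A derivation $D$ of $L$ is called restricted if $D(x^{[p]})=(\mathrm{ad}_L x)^{p-1}(D(x))$ for every $x\in L$. A derivation is inner if it equals $\mathrm{ad}_L a$ for some $a\in L$; an outer restricted derivation is a restricted derivation that is not inner. An element $x\in L$ is semisimple if $x\in\langle x^{[p]}\rangle_p$, where $\langle S\rangle_p$ denotes the $p$-subalgebra (subalgebra closed under the $p$-mapping) generated by $S$; a torus is an abelian restricted Lie algebra all of whose elements are semisimple. *)

theory Defs
  imports "HOL-Computational_Algebra.Computational_Algebra"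
begin

locale lie_algebra = vector_space scale
  for scale :: "'a::field \<Rightarrow> 'l::ab_group_add \<Rightarrow> 'l" (infixr \<open>*s\<close> 75) +
  fixes bracket :: "'l \<Rightarrow> 'l \<Rightarrow> 'l"
  assumes bracket_add_left: "bracket (x + y) z = bracket x z + bracket y z"
    and bracket_add_right: "bracket x (y + z) = bracket x y + bracket x z"
    and bracket_scale_left: "bracket (c *s x) y = c *s bracket x y"
    and bracket_scale_right: "bracket x (c *s y) = c *s bracket x y"
    and bracket_self: "bracket x x = 0"
    and jacobi: "bracket x (bracket y z) + bracket y (bracket z x) + bracket z (bracket x y) = 0"
begin

definition ad :: "'l \<Rightarrow> 'l \<Rightarrow> 'l" where
  "ad x = (\<lambda>y. bracket x y)"

definition abelian :: bool where
  "abelian \<longleftrightarrow> (\<forall>x y. bracket x y = 0)"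

(* The index is shifted by one: lower_central 0 is all of L. *)
primrec lower_central :: "nat \<Rightarrow> 'l set" where
  "lower_central 0 = UNIV"
| "lower_central (Suc n) = span {bracket x y | x y. y \<in> lower_central n}"

definition nilpotent :: bool where
  "nilpotent \<longleftrightarrow> (\<exists>n. lower_central n = {0})"

definition derivation :: "('l \<Rightarrow> 'l) \<Rightarrow> bool" where
  "derivation D \<longleftrightarrow> Vector_Spaces.linear scale scale D \<and>
     (\<forall>x y. D (bracket x y) = bracket (D x) y + bracket x (D y))"

definition inner_derivation :: "('l \<Rightarrow> 'l) \<Rightarrow> bool" where
  "inner_derivation D \<longleftrightarrow> (\<exists>a. D = ad a)"

definition lie_subalgebra :: "'l set \<Rightarrow> bool" where
  "lie_subalgebra S \<longleftrightarrow> subspace S \<and> (\<forall>x\<in>S. \<forall>y\<in>S. bracket x y \<in> S)"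

(* The Lie bracket of L[T], the tensor product of L with the polynomial ring F[T];
   the type 'l poly serves as its underlying group. *)
definition poly_bracket :: "'l poly \<Rightarrow> 'l poly \<Rightarrow> 'l poly" where
  "poly_bracket f g =
     (\<Sum>i\<le>degree f. \<Sum>j\<le>degree g. monom (bracket (coeff f i) (coeff g j)) (i + j))"

(* Jacobson's s_i(x, y) for 0 < i < p, determined by
   (ad (x T + y))^(p - 1) (x) = sum of i s_i(x, y) T^(i - 1) over 0 < i < p, in L[T]. *)
definition jacobson_s :: "nat \<Rightarrow> nat \<Rightarrow> 'l \<Rightarrow> 'l \<Rightarrow> 'l" where
  "jacobson_s p i x y =
     inverse (of_nat i) *s coeff ((poly_bracket [:y, x:] ^^ (p - 1)) [:x:]) (i - 1)"

end

locale restricted_lie_algebra = lie_algebra scale bracket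
  for scale :: "'a::field \<Rightarrow> 'l::ab_group_add \<Rightarrow> 'l" (infixr \<open>*s\<close> 75)
    and bracket :: "'l \<Rightarrow> 'l \<Rightarrow> 'l" +
  fixes p :: nat and pmap :: "'l \<Rightarrow> 'l"
  assumes char_eq: "CHAR('a) = p"
    and char_pos: "p > 0"
    and ad_pmap: "ad (pmap x) = ad x ^^ p"
    and pmap_scale: "pmap (c *s x) = c ^ p *s pmap x"
    and pmap_add: "pmap (x + y) = pmap x + pmap y + (\<Sum>i = 1..<p. jacobson_s p i x y)"
begin

definition p_subalgebra :: "'l set \<Rightarrow> bool" where
  "p_subalgebra S \<longleftrightarrow> lie_subalgebra S \<and> (\<forall>x\<in>S. pmap x \<in> S)"

definition p_generated :: "'l set \<Rightarrow> 'l set" where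
  "p_generated S = p_subalgebra hull S"

definition semisimple :: "'l \<Rightarrow> bool" where
  "semisimple x \<longleftrightarrow> x \<in> p_generated {pmap x}"

definition torus :: bool where
  "torus \<longleftrightarrow> abelian \<and> (\<forall>x. semisimple x)"

definition restricted_derivation :: "('l \<Rightarrow> 'l) \<Rightarrow> bool" where
  "restricted_derivation D \<longleftrightarrow>
     derivation D \<and> (\<forall>x. D (pmap x) = (ad x ^^ (p - 1)) (D x))"

definition outer_restricted_derivation :: "('l \<Rightarrow> 'l) \<Rightarrow> bool" where
  "outer_restricted_derivation D \<longleftrightarrow> restricted_derivation D \<and> \<not> inner_derivation D"

end

end

theory Submission
  imports Defs
begin

text \<open>Let \<open>L\<close> be nilpotent and finite-dimensional, and suppose that every restricted derivation of \<open>L\<close>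
  is inner. The proof is a dimension count against the module-theoretic fact that, for the restricted
  enveloping algebra of a \<open>p\<close>-nilpotent algebra, a module without first cohomology is free; only the
  consequences of freeness for dimensions are needed, and these can be reached one hyperplane at a time.

  For a \<open>p\<close>-ideal \<open>J\<close> let \<open>all_inner_on J\<close> say that every restricted derivation \<open>J \<rightarrow> L\<close> is the
  restriction of some \<open>ad a\<close> with \<open>a \<in> L\<close>, so the first restricted cohomology of \<open>J\<close> with values in \<open>L\<close>
  vanishes. If \<open>J\<close> is not the span of \<open>[L, J]\<close> and \<open>J\<^sup>[\<^sup>p\<^sup>]\<close>, it has a hyperplane \<open>I\<close> containing both,
  and \<open>J = I + F x\<close>. Write \<open>C(J)\<close> for the centralizer of \<open>J\<close> in \<open>L\<close>. Two things follow from
  \<open>all_inner_on J\<close>.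

  \<^item> A derivation that kills \<open>I\<close> and sends \<open>x\<close> to \<open>z \<in> C(I)\<close> is restricted if and only if
    \<open>(ad x)\<^bsup>p-1\<^esup> z = 0\<close>, and it is inner if and only if \<open>z \<in> [x, C(I)]\<close>. Hence on \<open>C(I)\<close> the kernel
    of \<open>(ad x)\<^bsup>p-1\<^esup>\<close> lies in the image of \<open>ad x\<close>, so \<open>C(I)\<close> has dimension at least \<open>p\<close> times
    that of \<open>C(J)\<close>, the kernel of \<open>ad x\<close> on it (\<open>centralizer_I_divisible\<close>, \<open>dim_centralizer_hyperplane\<close>).

  \<^item> The property passes to \<open>I\<close> (\<open>all_inner_on_I\<close>). The commutator \<open>[ad x, \<delta>]\<close> of a restricted
    derivation \<open>\<delta>\<close> of \<open>I\<close> is again one, and iterating it gives \<open>0\<close> because \<open>L\<close> is nilpotent. So by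
    induction \<open>[ad x, \<delta>]\<close> is inner, which is exactly what makes \<open>\<delta>\<close> extendable to a derivation of \<open>J\<close>; the
    divisibility property of \<open>C(I)\<close> permits a choice of the value at \<open>x\<close> that makes the extension
    restricted. The extension is inner, and so is \<open>\<delta>\<close>.

  The descent from \<open>J = L\<close> stops at a \<open>p\<close>-ideal that is the span of \<open>[L, J]\<close> and \<open>J\<^sup>[\<^sup>p\<^sup>]\<close>, and by
  nilpotency such a \<open>J\<close> is central. With \<open>n\<close> steps and \<open>r = dim Z(L)\<close> this gives
  \<open>p\<^sup>n r \<le> dim L \<le> n + r\<close>, so that \<open>dim L \<le> r + 1\<close> and \<open>L\<close> is abelian. An abelian \<open>L\<close>
  that is not a torus is not spanned by \<open>L\<^sup>[\<^sup>p\<^sup>]\<close>, hence the descent has a first step, and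
  \<open>p dim L \<le> dim L\<close> is absurd.

  Two facts about restrictedness support the descent: it suffices to check it on elements that span
  (\<open>derivation_on_restricted_add\<close>), and it is inherited by commutators with \<open>ad x\<close>
  (\<open>restricted_derivation_on_commutator\<close>). Both come down to one symmetry of iterated brackets in
  characteristic \<open>p\<close> (\<open>bracket_pow_sum_symmetric\<close>).\<close>

section \<open>Linear algebra\<close>

context vector_space
begin

lemma separating_functional:
  assumes "subspace M" "x \<notin> M"
  obtains f :: "'b \<Rightarrow> 'a" where "\<And>y z. f (y + z) = f y + f z" "\<And>c y. f (scale c y) = c * f y"
    "f x = 1" "\<And>y. y \<in> M \<Longrightarrow> f y = 0"
proof -
  interpret F: vector_space "(*) :: 'a \<Rightarrow> 'a \<Rightarrow> 'a"
    by unfold_locales (auto simp: algebra_simps)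
  interpret P: vector_space_pair scale "(*) :: 'a \<Rightarrow> 'a \<Rightarrow> 'a" ..
  obtain B where B: "B \<subseteq> M" "independent B" "M \<subseteq> span B"
    by (rule maximal_independent_subset)
  have "span B = M" using B assms(1) by (metis span_minimal subset_antisym)
  then have "x \<notin> span B" using assms(2) by simp
  then have "independent (insert x B)" using B(2) by (rule independent_insertI)
  from P.linear_independent_extend[OF this, of "\<lambda>y. if y = x then 1 else 0"]
  obtain f where f: "Vector_Spaces.linear scale (*) f"
    "\<forall>y\<in>insert x B. f y = (if y = x then 1 else 0)" by blast
  interpret f: Vector_Spaces.linear scale "(*)" f by (rule f(1))
  have zero: "f y = 0" if "y \<in> M" for y
  proof (rule f.eq_0_on_span)
    show "y \<in> span B" using that \<open>span B = M\<close> by simp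
    show "f b = 0" if "b \<in> B" for b
      using that f(2) B(1) assms(2) by auto
  qed
  have "f x = 1" using f(2) by simp
  then show ?thesis by (intro that[of f]) (simp_all add: f.add f.scale zero)
qed

end

context finite_dimensional_vector_space
begin

text \<open>Rank-nullity for the restriction of \<open>N\<close> to \<open>V\<close>, as an inequality: a linear section of \<open>N\<close> over
  \<open>W\<close> embeds \<open>W\<close> into \<open>V\<close> with image independent of the kernel.\<close>

lemma dim_kernel_plus_image_le:
  assumes N: "Vector_Spaces.linear scale scale N" and V: "subspace V" and W: "subspace W" "W \<subseteq> N ` V"
  shows "dim W + dim {v \<in> V. N v = 0} \<le> dim V"
proof -
  interpret P: vector_space_pair scale scale ..
  interpret N: Vector_Spaces.linear scale scale N by (rule N)
  interpret P1: finite_dimensional_vector_space_pair_1 scale Basis scale ..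
  obtain B where B: "B \<subseteq> W" "independent B" "W \<subseteq> span B"
    by (rule maximal_independent_subset)
  have spanB: "span B = W" using B W(1) by (metis span_minimal subset_antisym)
  define pre where "pre w = (SOME v. v \<in> V \<and> N v = w)" for w
  have pre: "pre w \<in> V" "N (pre w) = w" if "w \<in> W" for w
    using someI_ex[of "\<lambda>v. v \<in> V \<and> N v = w"] that W(2) unfolding pre_def by (metis (lifting) image_iff subsetD)+
  obtain g where g: "Vector_Spaces.linear scale scale g" "\<forall>b\<in>B. g b = pre b"
    using P.linear_independent_extend[OF B(2), of pre] by blast
  interpret g: Vector_Spaces.linear scale scale g by (rule g(1))
  have gW: "g w \<in> V \<and> N (g w) = w" if "w \<in> W" for w
  proof -
    have "w \<in> span B" using that spanB by simp
    then show ?thesis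
    proof (induction rule: span_induct_alt)
      case base
      show ?case using subspace_0[OF V] by (simp add: g.zero N.zero)
    next
      case (step c b y)
      then show ?case using pre[of b] B(1) g(2) V
        by (auto simp: g.add g.scale N.add N.scale subspace_add subspace_scale)
    qed
  qed
  let ?K = "{v \<in> V. N v = 0}"
  have K: "subspace ?K"
    using V by (auto simp: subspace_def N.zero N.add N.scale)
  have S: "subspace (g ` W)" by (rule g.subspace_image[OF W(1)])
  have "g ` W \<inter> ?K \<subseteq> {0}"
    using gW by (auto simp: g.zero)
  then have int: "dim (g ` W \<inter> ?K) = 0" by (simp only: dim_eq_0)
  have "inj_on g W" by (rule inj_on_inverseI[of _ N]) (use gW in auto)
  moreover have "span W = W" using W(1) span_eq_iff by blast
  ultimately have "dim (g ` W) = dim W"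
    using P1.dim_image_eq[OF g(1), of W] by metis
  moreover have "dim {x + y |x y. x \<in> g ` W \<and> y \<in> ?K} + dim (g ` W \<inter> ?K) = dim (g ` W) + dim ?K"
    by (rule dim_sums_Int[OF S K])
  moreover have "dim {x + y |x y. x \<in> g ` W \<and> y \<in> ?K} \<le> dim V"
    by (rule dim_subset) (use gW V in \<open>auto intro: subspace_add\<close>)
  ultimately show ?thesis using int by simp
qed

text \<open>Divisibility makes \<open>N\<close> map \<open>ker N\<^bsup>j+1\<^esup>\<close> onto \<open>ker N\<^sup>j\<close> for each \<open>j \<le> q\<close>, so each of the
  first \<open>q + 1\<close> kernels exceeds the preceding one by the dimension of \<open>ker N\<close>. If \<open>N\<close> maps \<open>C\<close>
  to itself, this says that none of its Jordan blocks with eigenvalue \<open>0\<close> is shorter than \<open>q + 1\<close>.\<close>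

lemma dim_ge_of_divisible_kernel:
  assumes N: "Vector_Spaces.linear scale scale N" and C: "subspace C"
    and divisible: "\<And>z. z \<in> C \<Longrightarrow> (N ^^ q) z = 0 \<Longrightarrow> \<exists>c\<in>C. z = N c"
  shows "Suc q * dim {z \<in> C. N z = 0} \<le> dim C"
proof -
  interpret N: Vector_Spaces.linear scale scale N by (rule N)
  let ?K = "\<lambda>j. {z \<in> C. (N ^^ j) z = 0}"
  have N0: "(N ^^ j) 0 = 0" for j by (induction j) (simp_all add: N.zero)
  have Nadd: "(N ^^ j) (a + b) = (N ^^ j) a + (N ^^ j) b" for j a b
    by (induction j) (simp_all add: N.add)
  have Nscale: "(N ^^ j) (scale c a) = scale c ((N ^^ j) a)" for j c a
    by (induction j) (simp_all add: N.scale)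
  have sub: "subspace (?K j)" for j
    using C by (auto simp: subspace_def N0 Nadd Nscale)
  have "j * dim {z \<in> C. N z = 0} \<le> dim (?K j)" if "j \<le> Suc q" for j
    using that
  proof (induction j)
    case 0
    show ?case by simp
  next
    case (Suc j)
    have "?K j \<subseteq> N ` ?K (Suc j)"
    proof
      fix z assume z: "z \<in> ?K j"
      have "(N ^^ q) z = (N ^^ (q - j)) ((N ^^ j) z)"
        using Suc.prems by (simp flip: funpow_add comp_apply[of "N ^^ (q - j)"])
      then have "(N ^^ q) z = 0" using z by (simp add: N0)
      then obtain c where "c \<in> C" "z = N c" using divisible z by blast
      then show "z \<in> N ` ?K (Suc j)" using z by (auto simp: funpow_swap1)
    qed
    from dim_kernel_plus_image_le[OF N sub sub this]
    have "dim (?K j) + dim {v \<in> ?K (Suc j). N v = 0} \<le> dim (?K (Suc j))" .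
    moreover have "{v \<in> ?K (Suc j). N v = 0} = {z \<in> C. N z = 0}"
      by (auto simp: funpow_swap1 N0)
    ultimately show ?case using Suc by simp
  qed
  from this[of "Suc q"] have "Suc q * dim {z \<in> C. N z = 0} \<le> dim (?K (Suc q))" by simp
  also have "\<dots> \<le> dim C" by (rule dim_subset) auto
  finally show ?thesis .
qed

end

section \<open>Iterated brackets\<close>

context lie_algebra
begin

lemma bracket_zero_left [simp]: "bracket 0 y = 0"
  using bracket_add_left[of 0 0 y] by simp

lemma bracket_zero_right [simp]: "bracket x 0 = 0"
  using bracket_add_right[of x 0 0] by simp

lemma bracket_minus_left: "bracket (- x) y = - bracket x y"
  using bracket_add_left[of x "- x" y] by (simp add: eq_neg_iff_add_eq_0 add.commute)

lemma bracket_minus_right: "bracket x (- y) = - bracket x y"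
  using bracket_add_right[of x y "- y"] by (simp add: eq_neg_iff_add_eq_0 add.commute)

lemma bracket_diff_left: "bracket (x - y) z = bracket x z - bracket y z"
  using bracket_add_left[of x "- y" z] by (simp add: bracket_minus_left)

lemma bracket_diff_right: "bracket x (y - z) = bracket x y - bracket x z"
  using bracket_add_right[of x y "- z"] by (simp add: bracket_minus_right)

lemmas bracket_linear_simps =
  bracket_add_left bracket_add_right bracket_diff_left bracket_diff_right
  bracket_minus_left bracket_minus_right bracket_scale_left bracket_scale_right

lemma bracket_anticomm: "bracket x y = - bracket y x"
proof -
  have "bracket x x + bracket y x + (bracket x y + bracket y y) = 0"
    using bracket_self[of "x + y"] unfolding bracket_add_left bracket_add_right .
  then show ?thesis by (simp add: bracket_self eq_neg_iff_add_eq_0 add.commute)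
qed

text \<open>The Jacobi identity in the form in which it is used: \<open>ad x\<close> is a derivation.\<close>

lemma bracket_leibniz:
  "bracket x (bracket y z) = bracket (bracket x y) z + bracket y (bracket x z)"
proof -
  have "bracket (bracket x y) z = - bracket z (bracket x y)"
    by (rule bracket_anticomm)
  moreover have "bracket y (bracket x z) = - bracket y (bracket z x)"
    by (subst bracket_anticomm[of x z]) (simp add: bracket_minus_right)
  moreover have "bracket x (bracket y z) = - (bracket y (bracket z x) + bracket z (bracket x y))"
    using jacobi[of x y z] by (simp only: eq_neg_iff_add_eq_0 add.assoc)
  ultimately show ?thesis by simp
qed

lemma bracket_sum_right: "bracket x (sum f A) = (\<Sum>i\<in>A. bracket x (f i))"
  by (induction A rule: infinite_finite_induct) (simp_all add: bracket_add_right)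

lemma bracket_pow_zero [simp]: "(bracket x ^^ n) 0 = 0"
  by (induction n) simp_all

lemma bracket_pow_minus: "(bracket x ^^ n) (- a) = - (bracket x ^^ n) a"
  by (induction n) (simp_all add: bracket_minus_right)

lemma bracket_pow_diff: "(bracket x ^^ n) (a - b) = (bracket x ^^ n) a - (bracket x ^^ n) b"
  by (induction n) (simp_all add: bracket_diff_right)

lemma bracket_pow_scale: "(bracket x ^^ n) (c *s a) = c *s (bracket x ^^ n) a"
  by (induction n) (simp_all add: bracket_scale_right)

lemma scale_bracket_pow: "(bracket (c *s x) ^^ n) a = c ^ n *s (bracket x ^^ n) a"
  by (induction n) (simp_all add: bracket_scale_left bracket_scale_right)

text \<open>By the Leibniz rule \<open>ad u\<close> acts on a bracket of its iterates as \<open>A + B\<close>, with \<open>A\<close> and \<open>B\<close> acting on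
  the two factors. The identity is \<open>A \<Sum> (A + B)\<^sup>j B\<^bsup>n-1-j\<^esup> = (A + B)\<^sup>n - B\<^sup>n\<close>
  with the factor \<open>A\<close> cancelled.\<close>

lemma bracket_pow_sum_choose:
  "(\<Sum>j<n. (bracket u ^^ j) (bracket a ((bracket u ^^ (n - 1 - j)) b)))
     = (\<Sum>m<n. of_nat (n choose Suc m) *s bracket ((bracket u ^^ m) a) ((bracket u ^^ (n - 1 - m)) b))"
proof (induction n)
  case 0
  show ?case by simp
next
  case (Suc n)
  let ?T = "\<lambda>i j. bracket ((bracket u ^^ i) a) ((bracket u ^^ j) b)"
  have "(\<Sum>j<Suc n. (bracket u ^^ j) (bracket a ((bracket u ^^ (Suc n - 1 - j)) b)))
      = ?T 0 n + bracket u (\<Sum>j<n. (bracket u ^^ j) (bracket a ((bracket u ^^ (n - 1 - j)) b)))"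
    by (subst sum.lessThan_Suc_shift) (simp add: bracket_sum_right)
  also have "\<dots> = ?T 0 n + (\<Sum>m<n. of_nat (n choose Suc m) *s bracket u (?T m (n - 1 - m)))"
    unfolding Suc.IH by (simp add: bracket_sum_right bracket_scale_right)
  also have "(\<Sum>m<n. of_nat (n choose Suc m) *s bracket u (?T m (n - 1 - m)))
      = (\<Sum>m<n. of_nat (n choose Suc m) *s ?T (Suc m) (n - Suc m))
        + (\<Sum>m<n. of_nat (n choose Suc m) *s ?T m (n - m))"
  proof -
    have "bracket u (?T m (n - 1 - m)) = ?T (Suc m) (n - Suc m) + ?T m (n - m)" if "m < n" for m
    proof -
      have "n - m = Suc (n - 1 - m)" using that by simp
      then show ?thesis by (simp add: bracket_leibniz[of u])
    qed
    then show ?thesis by (simp add: scale_right_distrib sum.distrib)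
  qed
  also have "?T 0 n + (\<dots>) = (\<Sum>m<Suc n. of_nat (n choose m) *s ?T m (n - m))
        + (\<Sum>m<Suc n. of_nat (n choose Suc m) *s ?T m (n - m))"
    by (subst sum.lessThan_Suc_shift) (simp add: add.assoc binomial_eq_0)
  also have "\<dots> = (\<Sum>m<Suc n. of_nat (Suc n choose Suc m) *s ?T m (Suc n - 1 - m))"
    by (simp add: scale_left_distrib sum.distrib del: sum.lessThan_Suc)
  finally show ?case .
qed

text \<open>Moving \<open>E\<close> past \<open>n\<close> applications of \<open>ad u\<close> picks up one commutator \<open>[E, ad u] = ad (E u)\<close> at each
  place. The Leibniz rule is assumed on the orbit of \<open>v\<close> only, because \<open>E\<close> will often be a derivation
  only on a subalgebra.\<close>

lemma derivation_bracket_pow: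
  assumes "\<And>k. E (bracket u ((bracket u ^^ k) v))
      = bracket (E u) ((bracket u ^^ k) v) + bracket u (E ((bracket u ^^ k) v))"
  shows "E ((bracket u ^^ n) v) = (bracket u ^^ n) (E v)
      + (\<Sum>j<n. (bracket u ^^ j) (bracket (E u) ((bracket u ^^ (n - 1 - j)) v)))"
proof (induction n)
  case 0
  show ?case by simp
next
  case (Suc n)
  have "(\<Sum>j<Suc n. (bracket u ^^ j) (bracket (E u) ((bracket u ^^ (Suc n - 1 - j)) v)))
      = bracket (E u) ((bracket u ^^ n) v)
        + bracket u (\<Sum>j<n. (bracket u ^^ j) (bracket (E u) ((bracket u ^^ (n - 1 - j)) v)))"
    by (subst sum.lessThan_Suc_shift) (simp add: bracket_sum_right)
  with assms[of n] Suc.IH show ?case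
    by (simp add: bracket_add_right add_ac del: sum.lessThan_Suc)
qed

text \<open>The case \<open>n = p\<close> of \<open>bracket_pow_sum_choose\<close>, where only the last binomial coefficient survives.\<close>

lemma bracket_pow_sum_char:
  assumes "CHAR('a) = p" "p > 0"
  shows "(\<Sum>j<p. (bracket u ^^ j) (bracket a ((bracket u ^^ (p - 1 - j)) b)))
    = bracket ((bracket u ^^ (p - 1)) a) b"
proof -
  have "prime p" using assms prime_CHAR_semidom by metis
  obtain q where q: "p = Suc q" using assms by (cases p) auto
  have "of_nat (p choose Suc m) = (0 :: 'a)" if "m < q" for m
    using dvd_choose_prime[of "Suc m" p] \<open>prime p\<close> that q assms
        of_nat_eq_0_iff_char_dvd[where 'a = 'a, of "p choose Suc m"]
    by auto
  then show ?thesis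
    unfolding bracket_pow_sum_choose by (simp add: q binomial_eq_0)
qed

text \<open>Exchanging \<open>a\<close> and \<open>b\<close> and using anticommutativity turns the coefficient of the \<open>m\<close>-th term of
  \<open>bracket_pow_sum_choose\<close> into \<open>-binomial (p - 1) m\<close>. The difference of the two sides therefore has
  coefficients \<open>binomial (p - 1) (m + 1) + binomial (p - 1) m = binomial p (m + 1)\<close>, which vanish.
  For two commuting derivations \<open>D\<close> and \<open>E\<close> and \<open>a = E u\<close>, \<open>b = D u\<close>, this says that
  \<open>D ((ad u)\<^bsup>p-1\<^esup> (E u)) = E ((ad u)\<^bsup>p-1\<^esup> (D u))\<close>.\<close>

lemma bracket_pow_sum_symmetric:
  assumes "CHAR('a) = p" "p > 0"
  shows "(\<Sum>j<p - 1. (bracket u ^^ j) (bracket a ((bracket u ^^ (p - 1 - 1 - j)) b)))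
    = (\<Sum>j<p - 1. (bracket u ^^ j) (bracket b ((bracket u ^^ (p - 1 - 1 - j)) a)))"
proof -
  have "prime p" using assms prime_CHAR_semidom by metis
  obtain q where q: "p = Suc q" using assms by (cases p) auto
  let ?T = "\<lambda>i j. bracket ((bracket u ^^ i) a) ((bracket u ^^ j) b)"
  have "(\<Sum>m<q. of_nat (q choose Suc m) *s bracket ((bracket u ^^ m) b) ((bracket u ^^ (q - 1 - m)) a))
      = - (\<Sum>m<q. of_nat (q choose Suc m) *s ?T (q - 1 - m) m)"
    by (subst bracket_anticomm) (simp add: sum_negf)
  also have "(\<Sum>m<q. of_nat (q choose Suc m) *s ?T (q - 1 - m) m)
      = (\<Sum>m<q. of_nat (q choose m) *s ?T m (q - 1 - m))"
  proof (rule sum.reindex_bij_witness[where i = "\<lambda>m. q - 1 - m" and j = "\<lambda>m. q - 1 - m"])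
    fix m assume "m \<in> {..<q}"
    then have m: "m < q" "q - 1 - (q - 1 - m) = m" by auto
    have "q choose Suc m = q choose (q - 1 - m)"
      using binomial_symmetric[of "Suc m" q] m by simp
    then show "of_nat (q choose (q - 1 - m)) *s ?T (q - 1 - m) (q - 1 - (q - 1 - m))
        = of_nat (q choose Suc m) *s ?T (q - 1 - m) m"
      using m by simp
  qed auto
  finally have "(\<Sum>m<q. of_nat (q choose Suc m) *s ?T m (q - 1 - m))
      - (\<Sum>m<q. of_nat (q choose Suc m) *s bracket ((bracket u ^^ m) b) ((bracket u ^^ (q - 1 - m)) a))
      = (\<Sum>m<q. of_nat (p choose Suc m) *s ?T m (q - 1 - m))"
    by (simp add: q scale_left_distrib sum.distrib)
  also have "\<dots> = 0"
  proof (rule sum.neutral, safe)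
    fix m assume "m < q"
    then have "of_nat (p choose Suc m) = (0 :: 'a)"
      using dvd_choose_prime[of "Suc m" p] \<open>prime p\<close> q assms
        of_nat_eq_0_iff_char_dvd[where 'a = 'a, of "p choose Suc m"]
      by auto
    then show "of_nat (p choose Suc m) *s ?T m (q - 1 - m) = 0" by simp
  qed
  finally show ?thesis
    unfolding bracket_pow_sum_choose by (simp add: q)
qed

section \<open>The Lie algebra of polynomials\<close>

lemma coeff_poly_bracket:
  "coeff (poly_bracket f g) n = (\<Sum>i\<le>n. bracket (coeff f i) (coeff g (n - i)))"
proof -
  let ?b = "\<lambda>i j. bracket (coeff f i) (coeff g j)"
  have inner: "(\<Sum>j\<le>degree g. if i + j = n then ?b i j else 0)
      = (if i \<le> n then ?b i (n - i) else 0)" for i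
  proof (cases "i \<le> n")
    case True
    have "(\<Sum>j\<le>degree g. if i + j = n then ?b i j else 0)
        = (\<Sum>j\<le>degree g. if j = n - i then ?b i j else 0)"
      using True by (intro sum.cong) auto
    also have "\<dots> = ?b i (n - i)"
      by (simp add: coeff_eq_0)
    finally show ?thesis using True by simp
  next
    case False
    then show ?thesis by (auto intro!: sum.neutral)
  qed
  have "coeff (poly_bracket f g) n
      = (\<Sum>i\<le>degree f. \<Sum>j\<le>degree g. if i + j = n then ?b i j else 0)"
    by (simp add: poly_bracket_def coeff_sum)
  also have "\<dots> = (\<Sum>i\<le>degree f. if i \<le> n then ?b i (n - i) else 0)"
    by (simp add: inner)
  also have "\<dots> = (\<Sum>i\<le>max n (degree f). if i \<le> n then ?b i (n - i) else 0)"
    by (rule sum.mono_neutral_left) (auto simp: coeff_eq_0)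
  also have "\<dots> = (\<Sum>i\<le>n. if i \<le> n then ?b i (n - i) else 0)"
    by (rule sum.mono_neutral_right) auto
  finally show ?thesis by simp
qed

lemma poly_bracket_add_left: "poly_bracket (f + g) h = poly_bracket f h + poly_bracket g h"
  by (rule poly_eqI) (simp add: coeff_poly_bracket bracket_add_left sum.distrib)

lemma poly_bracket_add_right: "poly_bracket f (g + h) = poly_bracket f g + poly_bracket f h"
  by (rule poly_eqI) (simp add: coeff_poly_bracket bracket_add_right sum.distrib)

lemma poly_bracket_monom: "poly_bracket (monom a i) (monom b j) = monom (bracket a b) (i + j)"
proof (rule poly_eqI)
  fix n
  have "coeff (poly_bracket (monom a i) (monom b j)) n
      = (\<Sum>k\<le>n. if k = i then if n - i = j then bracket a b else 0 else 0)"
    unfolding coeff_poly_bracket by (intro sum.cong) auto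
  also have "\<dots> = coeff (monom (bracket a b) (i + j)) n"
    by auto
  finally show "coeff (poly_bracket (monom a i) (monom b j)) n
      = coeff (monom (bracket a b) (i + j)) n" .
qed

text \<open>In each coefficient the terms \<open>(i, n - i)\<close> and \<open>(n - i, i)\<close> cancel and a middle term is zero; anticommutativity
  alone would leave characteristic \<open>2\<close> open.\<close>

lemma poly_bracket_self: "poly_bracket f f = 0"
proof (rule poly_eqI)
  fix n
  let ?s = "\<lambda>i. bracket (coeff f i) (coeff f (n - i))"
  let ?A = "{i. i \<le> n \<and> i < n - i}" and ?B = "{i. i \<le> n \<and> n - i < i}" and ?C = "{i. i \<le> n \<and> i = n - i}"
  have "{..n} = (?A \<union> ?B) \<union> ?C" by auto
  then have "sum ?s {..n} = sum ?s ((?A \<union> ?B) \<union> ?C)" by (rule arg_cong)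
  also have "\<dots> = (sum ?s ?A + sum ?s ?B) + sum ?s ?C"
    by (subst sum.union_disjoint; (subst sum.union_disjoint)?) auto
  also have "sum ?s ?C = 0"
    by (rule sum.neutral) (auto simp: bracket_self)
  also have "sum ?s ?B = (\<Sum>i\<in>?A. - ?s i)"
    by (rule sum.reindex_bij_witness[where i = "\<lambda>i. n - i" and j = "\<lambda>i. n - i"])
       (auto simp: bracket_anticomm[symmetric])
  finally show "coeff (poly_bracket f f) n = coeff 0 n"
    by (simp add: coeff_poly_bracket sum_negf)
qed

lemma poly_monom_induct:
  fixes f :: "'l poly"
  assumes "\<And>a n. P (monom a n)" "\<And>f g. P f \<Longrightarrow> P g \<Longrightarrow> P (f + g)"
  shows "P f"
proof -
  have "P 0" using assms(1)[of 0 0] by simp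
  have "P (\<Sum>i\<in>A. monom (coeff f i) i)" if "finite A" for A
    using that by induction (auto intro: assms \<open>P 0\<close>)
  from this[of "{..degree f}"] show ?thesis
    by (simp add: poly_as_sum_of_monoms)
qed

text \<open>The Jacobi sum is additive in each argument, so monomials suffice.\<close>

lemma poly_bracket_jacobi:
  "poly_bracket f (poly_bracket g h) + poly_bracket g (poly_bracket h f) + poly_bracket h (poly_bracket f g) = 0"
  (is "?J f g h = 0")
proof -
  have add: "?J (f + f') g h = ?J f g h + ?J f' g h" "?J f (g + g') h = ?J f g h + ?J f g' h"
    "?J f g (h + h') = ?J f g h + ?J f g h'" for f f' g g' h h'
    by (simp_all only: poly_bracket_add_left poly_bracket_add_right ac_simps)
  have monom: "?J (monom a i) (monom b j) (monom c k) = 0" for a b c i j k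
  proof -
    have "?J (monom a i) (monom b j) (monom c k)
        = monom (bracket a (bracket b c) + bracket b (bracket c a) + bracket c (bracket a b)) (i + j + k)"
      by (simp add: poly_bracket_monom add_monom[symmetric] ac_simps)
    then show ?thesis by (simp add: jacobi)
  qed
  have "?J (monom a i) (monom b j) h = 0" for a b i j
    by (induction h rule: poly_monom_induct) (simp_all only: monom add add_0_left)
  then have "?J (monom a i) g h = 0" for a i
    by (induction g rule: poly_monom_induct) (simp_all only: add add_0_left)
  then show ?thesis
    by (induction f rule: poly_monom_induct) (simp_all only: add add_0_left)
qed

definition poly_scale :: "'a \<Rightarrow> 'l poly \<Rightarrow> 'l poly" where
  "poly_scale c = map_poly (scale c)"

lemma coeff_poly_scale [simp]: "coeff (poly_scale c f) n = c *s coeff f n"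
  by (simp add: poly_scale_def coeff_map_poly)

lemma lie_algebra_poly: "lie_algebra poly_scale poly_bracket"
proof unfold_locales
  fix c d :: 'a and f g h :: "'l poly"
  show "poly_scale c (f + g) = poly_scale c f + poly_scale c g"
    and "poly_scale (c + d) f = poly_scale c f + poly_scale d f"
    and "poly_scale c (poly_scale d f) = poly_scale (c * d) f"
    and "poly_scale 1 f = f"
    by (simp_all add: poly_eq_iff scale_right_distrib scale_left_distrib)
  show "poly_bracket (poly_scale c f) g = poly_scale c (poly_bracket f g)"
    and "poly_bracket f (poly_scale c g) = poly_scale c (poly_bracket f g)"
    by (simp_all add: poly_eq_iff coeff_poly_bracket bracket_scale_left bracket_scale_right
        scale_sum_right)
qed (fact poly_bracket_add_left poly_bracket_add_right poly_bracket_self poly_bracket_jacobi)+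

text \<open>The formal derivative \<open>d/dT\<close>, with the integer factors acting through the scalars of \<open>L\<close>.\<close>

definition poly_deriv :: "'l poly \<Rightarrow> 'l poly" where
  "poly_deriv f = (\<Sum>i\<le>degree f. monom (of_nat i *s coeff f i) (i - 1))"

lemma coeff_poly_deriv [simp]: "coeff (poly_deriv f) n = of_nat (Suc n) *s coeff f (Suc n)"
proof -
  have "coeff (poly_deriv f) n
      = (\<Sum>i\<le>degree f. if i = Suc n then of_nat i *s coeff f i else 0)"
    unfolding poly_deriv_def coeff_sum
  proof (intro sum.cong refl)
    fix i
    show "coeff (monom (of_nat i *s coeff f i) (i - 1)) n
        = (if i = Suc n then of_nat i *s coeff f i else 0)"
      by (cases i) auto
  qed
  also have "\<dots> = of_nat (Suc n) *s coeff f (Suc n)"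
    by (simp add: coeff_eq_0 del: of_nat_Suc)
  finally show ?thesis .
qed

lemma poly_deriv_bracket:
  "poly_deriv (poly_bracket f g) = poly_bracket (poly_deriv f) g + poly_bracket f (poly_deriv g)"
proof (rule poly_eqI)
  fix n
  let ?b = "\<lambda>i. bracket (coeff f i) (coeff g (Suc n - i))"
  have "of_nat (Suc n) *s sum ?b {..Suc n}
      = (\<Sum>i\<le>Suc n. of_nat i *s ?b i) + (\<Sum>i\<le>Suc n. of_nat (Suc n - i) *s ?b i)"
  proof -
    have "of_nat (Suc n) *s ?b i = of_nat i *s ?b i + of_nat (Suc n - i) *s ?b i"
      if "i \<le> Suc n" for i
      using that by (simp flip: scale_left_distrib of_nat_add del: of_nat_Suc)
    then show ?thesis by (simp add: scale_sum_right sum.distrib del: of_nat_Suc sum.atMost_Suc)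
  qed
  also have "(\<Sum>i\<le>Suc n. of_nat i *s ?b i)
      = (\<Sum>i\<le>n. bracket (of_nat (Suc i) *s coeff f (Suc i)) (coeff g (n - i)))"
    by (subst sum.atMost_Suc_shift) (simp add: bracket_scale_left del: of_nat_Suc)
  also have "(\<Sum>i\<le>Suc n. of_nat (Suc n - i) *s ?b i)
      = (\<Sum>i\<le>n. bracket (coeff f i) (of_nat (Suc (n - i)) *s coeff g (Suc (n - i))))"
    by (simp add: bracket_scale_right Suc_diff_le del: of_nat_Suc of_nat_diff)
  finally show "coeff (poly_deriv (poly_bracket f g)) n
      = coeff (poly_bracket (poly_deriv f) g + poly_bracket f (poly_deriv g)) n"
    by (simp add: coeff_poly_bracket del: of_nat_Suc)
qed

lemma coeff_linear_poly_bracket: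
  "coeff (poly_bracket [:y, x:] f) 0 = bracket y (coeff f 0)"
  "coeff (poly_bracket [:y, x:] f) (Suc n) = bracket y (coeff f (Suc n)) + bracket x (coeff f n)"
proof -
  show "coeff (poly_bracket [:y, x:] f) 0 = bracket y (coeff f 0)"
    by (simp add: coeff_poly_bracket)
  have "bracket (coeff [:y, x:] (Suc i)) z = (if i = 0 then bracket x z else 0)" for i z
    by (cases i) simp_all
  then have "coeff (poly_bracket [:y, x:] f) (Suc n)
      = bracket y (coeff f (Suc n)) + (\<Sum>i\<le>n. if i = 0 then bracket x (coeff f n) else 0)"
    unfolding coeff_poly_bracket
    by (subst sum.atMost_Suc_shift) (auto simp del: coeff_pCons_Suc intro!: sum.cong)
  then show "coeff (poly_bracket [:y, x:] f) (Suc n)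
      = bracket y (coeff f (Suc n)) + bracket x (coeff f n)"
    by simp
qed

lemma linear_poly_bracket_pow_coeff_0:
  "coeff ((poly_bracket [:y, x:] ^^ k) f) 0 = (bracket y ^^ k) (coeff f 0)"
  by (induction k) (simp_all add: coeff_linear_poly_bracket)

text \<open>Iterating \<open>ad (x T + y)\<close> raises the degree by at most one each time, and the top coefficient sees \<open>x\<close> only.\<close>

lemma linear_poly_bracket_pow_coeff_top:
  assumes "\<And>i. i > m \<Longrightarrow> coeff f i = 0"
  shows "(\<forall>i > m + k. coeff ((poly_bracket [:y, x:] ^^ k) f) i = 0)
    \<and> coeff ((poly_bracket [:y, x:] ^^ k) f) (m + k) = (bracket x ^^ k) (coeff f m)"
proof (induction k)
  case 0
  show ?case using assms by simp
next
  case (Suc k)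
  let ?g = "(poly_bracket [:y, x:] ^^ k) f"
  have "coeff (poly_bracket [:y, x:] ?g) i = 0" if i: "i > m + Suc k" for i
  proof -
    obtain j where "i = Suc j" "j > m + k" using i by (cases i) auto
    then show ?thesis using Suc.IH by (simp add: coeff_linear_poly_bracket)
  qed
  moreover have "coeff (poly_bracket [:y, x:] ?g) (Suc (m + k)) = (bracket x ^^ Suc k) (coeff f m)"
    using Suc.IH by (simp add: coeff_linear_poly_bracket)
  ultimately show ?case by simp
qed

text \<open>The sum of all coefficients is the value at \<open>T = 1\<close>, and evaluation at \<open>1\<close> carries \<open>ad (x T + y)\<close> to
  \<open>ad (x + y)\<close>.\<close>

lemma linear_poly_bracket_pow_coeff_sum:
  assumes "\<And>i. i > m \<Longrightarrow> coeff f i = 0"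
  shows "(\<Sum>i\<le>m + k. coeff ((poly_bracket [:y, x:] ^^ k) f) i) = (bracket (x + y) ^^ k) (\<Sum>i\<le>m. coeff f i)"
proof (induction k)
  case 0
  show ?case by simp
next
  case (Suc k)
  let ?g = "(poly_bracket [:y, x:] ^^ k) f"
  have top: "coeff ?g (Suc (m + k)) = 0"
    using linear_poly_bracket_pow_coeff_top[of m f k y x] assms by simp
  have "(\<Sum>i\<le>Suc (m + k). coeff (poly_bracket [:y, x:] ?g) i)
      = bracket y (\<Sum>i\<le>Suc (m + k). coeff ?g i) + bracket x (\<Sum>i\<le>m + k. coeff ?g i)"
    by (subst (1 2) sum.atMost_Suc_shift)
       (simp add: coeff_linear_poly_bracket bracket_sum_right bracket_add_right sum.distrib add_ac)
  also have "\<dots> = bracket (x + y) (\<Sum>i\<le>m + k. coeff ?g i)"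
    by (simp add: top bracket_add_left)
  finally show ?case
    using Suc.IH by simp
qed

section \<open>Derivations on subalgebras and the Jacobson terms\<close>

text \<open>A derivation from \<open>J\<close> to \<open>L\<close>. It is taken as a linear map on all of \<open>L\<close>, of which only the values on
  \<open>J\<close> matter, so that linearity needs no relativization.\<close>

definition derivation_on :: "'l set \<Rightarrow> ('l \<Rightarrow> 'l) \<Rightarrow> bool" where
  "derivation_on J D \<longleftrightarrow> Vector_Spaces.linear scale scale D \<and>
     (\<forall>x\<in>J. \<forall>y\<in>J. D (bracket x y) = bracket (D x) y + bracket x (D y))"

lemma linear_simps:
  assumes "Vector_Spaces.linear scale scale D"
  shows "D (x + y) = D x + D y" "D (x - y) = D x - D y" "D (- x) = - D x" "D 0 = 0"
    "D (c *s x) = c *s D x" "D (sum f A) = (\<Sum>i\<in>A. D (f i))"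
proof -
  interpret Vector_Spaces.linear scale scale D by fact
  show "D (x + y) = D x + D y" "D (x - y) = D x - D y" "D (- x) = - D x" "D 0 = 0"
    "D (c *s x) = c *s D x" "D (sum f A) = (\<Sum>i\<in>A. D (f i))"
    by (simp_all add: add diff neg zero scale sum)
qed

lemma linearI:
  assumes "\<And>x y. D (x + y) = D x + D y" "\<And>c x. D (c *s x) = c *s D x"
  shows "Vector_Spaces.linear scale scale D"
  using assms by unfold_locales

lemma derivation_onD:
  assumes "derivation_on J D"
  shows "Vector_Spaces.linear scale scale D"
    "x \<in> J \<Longrightarrow> y \<in> J \<Longrightarrow> D (bracket x y) = bracket (D x) y + bracket x (D y)"
  using assms by (auto simp: derivation_on_def)

lemma bracket_pow_mem:
  assumes "\<And>z. z \<in> J \<Longrightarrow> bracket x z \<in> J" "y \<in> J"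
  shows "(bracket x ^^ k) y \<in> J"
  by (induction k) (auto simp: assms)

text \<open>Put \<open>u = x T + y\<close> and \<open>G = (ad u)\<^bsup>p-1\<^esup> (D u)\<close> in \<open>L[T]\<close>, with \<open>D\<close> acting on coefficients.
  Since \<open>D\<close> and \<open>d/dT\<close> commute, \<open>bracket_pow_sum_symmetric\<close> gives
  \<open>dG/dT = D ((ad u)\<^bsup>p-1\<^esup> x)\<close>, and by the definition of the Jacobson terms this means that
  \<open>D (s\<^sub>i(x, y))\<close> is the coefficient of \<open>T\<^sup>i\<close> in \<open>G\<close> for \<open>0 < i < p\<close>. The right-hand side is
  \<open>G\<close> at \<open>T = 1\<close> without its two outer coefficients.\<close>

lemma derivation_on_jacobson_sum:
  assumes "CHAR('a) = p" "p > 0" and J: "lie_subalgebra J" and D: "derivation_on J D"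
    and x: "x \<in> J" and y: "y \<in> J"
  shows "D (\<Sum>i = 1..<p. jacobson_s p i x y)
    = (bracket (x + y) ^^ (p - 1)) (D (x + y)) - (bracket x ^^ (p - 1)) (D x) - (bracket y ^^ (p - 1)) (D y)"
proof -
  interpret LT: lie_algebra poly_scale poly_bracket by (rule lie_algebra_poly)
  note lin = linear_simps[OF derivation_onD(1)[OF D]]
  note leib = derivation_onD(2)[OF D]
  have "subspace J" using J by (simp add: lie_subalgebra_def)
  define u where "u = [:y, x:]"
  define E where "E = map_poly D"
  define G where "G = (poly_bracket u ^^ (p - 1)) (E u)"
  define H where "H = (poly_bracket u ^^ (p - 1)) [:x:]"
  have coeff_E: "coeff (E f) n = D (coeff f n)" for f n
    by (simp add: E_def coeff_map_poly lin)
  have E_leib: "E (poly_bracket f g) = poly_bracket (E f) g + poly_bracket f (E g)"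
    if "\<forall>n. coeff f n \<in> J" "\<forall>n. coeff g n \<in> J" for f g
    using that by (simp add: poly_eq_iff coeff_E coeff_poly_bracket lin leib sum.distrib)
  have u_J: "\<forall>n. coeff u n \<in> J"
    using x y subspace_0[OF \<open>subspace J\<close>] by (auto simp: u_def coeff_pCons split: nat.splits)
  have pow_J: "\<forall>n. coeff ((poly_bracket u ^^ k) [:x:]) n \<in> J" for k
  proof (induction k)
    case 0
    then show ?case using x subspace_0[OF \<open>subspace J\<close>] by (auto simp: coeff_pCons split: nat.splits)
  next
    case (Suc k)
    then show ?case
      using u_J J by (auto simp: coeff_poly_bracket lie_subalgebra_def intro!: subspace_sum)
  qed
  have du: "poly_deriv u = [:x:]"
    by (auto simp: poly_eq_iff u_def coeff_pCons split: nat.splits)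
  have "poly_deriv (E u) = E [:x:]"
    by (auto simp: poly_eq_iff coeff_E u_def coeff_pCons lin split: nat.splits)
  then have "poly_deriv G = (poly_bracket u ^^ (p - 1)) (E [:x:])
      + (\<Sum>j<p - 1. (poly_bracket u ^^ j) (poly_bracket [:x:] ((poly_bracket u ^^ (p - 1 - 1 - j)) (E u))))"
    unfolding G_def
    by (subst LT.derivation_bracket_pow) (simp_all add: poly_deriv_bracket du)
  also have "\<dots> = (poly_bracket u ^^ (p - 1)) (E [:x:])
      + (\<Sum>j<p - 1. (poly_bracket u ^^ j) (poly_bracket (E u) ((poly_bracket u ^^ (p - 1 - 1 - j)) [:x:])))"
    by (subst LT.bracket_pow_sum_symmetric[OF assms(1,2)]) (rule refl)
  also have "\<dots> = E H"
    unfolding H_def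
    by (subst LT.derivation_bracket_pow) (simp_all add: E_leib u_J pow_J)
  finally have deriv_G: "poly_deriv G = E H" .
  \<comment> \<open>The integration step: division by \<open>i\<close> is possible because \<open>0 < i < p\<close>.\<close>
  have s: "D (jacobson_s p i x y) = coeff G i" if "i \<in> {1..<p}" for i
  proof -
    have i: "i = Suc (i - 1)" and nz: "of_nat i \<noteq> (0 :: 'a)"
      using that assms of_nat_eq_0_iff_char_dvd[where 'a = 'a, of i] by (auto dest: dvd_imp_le)
    have "D (jacobson_s p i x y) = inverse (of_nat i) *s coeff (E H) (i - 1)"
      by (simp add: jacobson_s_def lin coeff_E H_def u_def)
    also have "\<dots> = inverse (of_nat i) *s of_nat i *s coeff G i"
      unfolding deriv_G[symmetric] coeff_poly_deriv using i by simp
    finally show ?thesis using nz by simp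
  qed
  have Eu: "coeff (E u) i = (if i = 0 then D y else if i = 1 then D x else 0)" for i
    by (auto simp: coeff_E u_def coeff_pCons lin split: nat.splits)
  then have vanish: "coeff (E u) i = 0" if "i > 1" for i using that by simp
  have "1 + (p - 1) = p" using \<open>p > 0\<close> by simp
  then have total: "(\<Sum>i\<le>p. coeff G i) = (bracket (x + y) ^^ (p - 1)) (D x + D y)"
    using linear_poly_bracket_pow_coeff_sum[of 1 "E u" "p - 1" y x] vanish
    by (simp add: G_def u_def[symmetric] Eu add.commute)
  have "coeff G 0 = (bracket y ^^ (p - 1)) (D y)"
    by (simp add: G_def u_def linear_poly_bracket_pow_coeff_0 Eu[unfolded u_def])
  moreover have "coeff G p = (bracket x ^^ (p - 1)) (D x)"
    using linear_poly_bracket_pow_coeff_top[of 1 "E u" "p - 1" y x] vanish \<open>1 + (p - 1) = p\<close>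
    by (simp add: G_def u_def[symmetric] Eu)
  moreover have "(\<Sum>i\<le>p. coeff G i) = coeff G 0 + (\<Sum>i = 1..<p. coeff G i) + coeff G p"
  proof -
    have "{..p} = insert 0 (insert p {1..<p})" using \<open>p > 0\<close> by auto
    then show ?thesis using \<open>p > 0\<close> by (simp add: algebra_simps)
  qed
  ultimately show ?thesis
    using total by (simp add: lin(6) s lin(1) algebra_simps)
qed

section \<open>Centralizers and the lower central series\<close>

definition centralizer :: "'l set \<Rightarrow> 'l set" where
  "centralizer J = {z. \<forall>y\<in>J. bracket y z = 0}"

lemma subspace_centralizer: "subspace (centralizer J)"
  by (simp add: centralizer_def subspace_def bracket_add_right bracket_scale_right)

lemma centralizer_commute: "z \<in> centralizer J \<Longrightarrow> y \<in> J \<Longrightarrow> bracket y z = 0 \<and> bracket z y = 0"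
  using bracket_anticomm[of z y] by (simp add: centralizer_def)

lemma subspace_lower_central: "subspace (lower_central n)"
  by (cases n) (simp_all add: subspace_UNIV)

lemma bracket_lower_central: "y \<in> lower_central n \<Longrightarrow> bracket x y \<in> lower_central (Suc n)"
  by (auto intro: span_base)

lemma lower_central_antimono:
  assumes "m \<le> n" shows "lower_central n \<subseteq> lower_central m"
proof -
  have "lower_central (Suc n) \<subseteq> lower_central n" for n
  proof (induction n)
    case (Suc n)
    then show ?case by (auto intro!: span_mono)
  qed simp
  then show ?thesis using assms by (rule lift_Suc_antimono_le)
qed

end

section \<open>Restricted derivations on p-ideals\<close>

context restricted_lie_algebra
begin

lemma p_ge_2: "p \<ge> 2"
  using prime_CHAR_semidom[where 'a = 'a] char_eq char_pos prime_ge_2_nat by metis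

lemma bracket_pmap: "bracket (pmap x) y = (bracket x ^^ p) y"
  using ad_pmap[of x] by (simp add: ad_def fun_eq_iff)

lemma funpow_p: "(f ^^ p) y = (f ^^ (p - 1)) (f y)"
proof -
  obtain q where "p = Suc q" using char_pos by (cases p) auto
  then show ?thesis by (simp add: funpow_swap1)
qed

lemma bracket_pmap_right: "bracket y (pmap x) = (bracket x ^^ (p - 1)) (bracket y x)"
  by (subst (1 2) bracket_anticomm) (simp add: bracket_pmap funpow_p bracket_pow_minus)

definition restricted_derivation_on :: "'l set \<Rightarrow> ('l \<Rightarrow> 'l) \<Rightarrow> bool" where
  "restricted_derivation_on J D \<longleftrightarrow>
     derivation_on J D \<and> (\<forall>x\<in>J. D (pmap x) = (bracket x ^^ (p - 1)) (D x))"

definition p_ideal :: "'l set \<Rightarrow> bool" where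
  "p_ideal J \<longleftrightarrow> subspace J \<and> (\<forall>x. \<forall>y\<in>J. bracket x y \<in> J) \<and> (\<forall>y\<in>J. pmap y \<in> J)"

lemma p_idealD:
  assumes "p_ideal J"
  shows "subspace J" "y \<in> J \<Longrightarrow> bracket x y \<in> J" "x \<in> J \<Longrightarrow> bracket x y \<in> J" "y \<in> J \<Longrightarrow> pmap y \<in> J"
    "lie_subalgebra J"
proof -
  show "subspace J" "y \<in> J \<Longrightarrow> bracket x y \<in> J" "y \<in> J \<Longrightarrow> pmap y \<in> J" "lie_subalgebra J"
    using assms by (auto simp: p_ideal_def lie_subalgebra_def)
  show "x \<in> J \<Longrightarrow> bracket x y \<in> J"
    using assms by (subst bracket_anticomm) (auto simp: p_ideal_def intro: subspace_neg)
qed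

text \<open>The obstruction \<open>D (x\<^sup>[\<^sup>p\<^sup>]) - (ad x)\<^bsup>p-1\<^esup> (D x)\<close> to restrictedness is additive in \<open>x\<close>, although
  neither term is, and it is compatible with scalars by the next lemma. So it can be tested on a spanning set.\<close>

lemma derivation_on_restricted_add:
  assumes J: "p_ideal J" and D: "derivation_on J D" and x: "x \<in> J" and y: "y \<in> J"
    and "D (pmap x) = (bracket x ^^ (p - 1)) (D x)" "D (pmap y) = (bracket y ^^ (p - 1)) (D y)"
  shows "D (pmap (x + y)) = (bracket (x + y) ^^ (p - 1)) (D (x + y))"
proof -
  note lin = linear_simps[OF derivation_onD(1)[OF D]]
  have "D (pmap (x + y)) = D (pmap x) + D (pmap y) + D (\<Sum>i = 1..<p. jacobson_s p i x y)"
    by (simp only: pmap_add lin)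
  then show ?thesis
    unfolding derivation_on_jacobson_sum[OF char_eq char_pos p_idealD(5)[OF J] D x y] assms by simp
qed

lemma derivation_on_restricted_scale:
  assumes D: "derivation_on J D" and "D (pmap x) = (bracket x ^^ (p - 1)) (D x)"
  shows "D (pmap (c *s x)) = (bracket (c *s x) ^^ (p - 1)) (D (c *s x))"
proof -
  note lin = linear_simps[OF derivation_onD(1)[OF D]]
  have "c ^ p = c ^ (p - 1) * c" using char_pos by (simp add: power_eq_if)
  then show ?thesis
    by (simp add: pmap_scale lin assms scale_bracket_pow bracket_pow_scale)
qed

text \<open>Compare the values of \<open>D\<close> on \<open>[x\<^sup>[\<^sup>p\<^sup>], y] = (ad x)\<^sup>p y\<close> computed in both ways;
  \<open>bracket_pow_sum_char\<close> evaluates the second.\<close>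

lemma derivation_on_defect_centralizes:
  assumes J: "p_ideal J" and D: "derivation_on J D" and x: "x \<in> J" and y: "y \<in> J"
  shows "bracket (D (pmap x) - (bracket x ^^ (p - 1)) (D x)) y = 0"
proof -
  note leib = derivation_onD(2)[OF D]
  have pow: "(bracket x ^^ k) y \<in> J" for k
    using bracket_pow_mem[of J x y] p_idealD(2)[OF J] y by blast
  have "D ((bracket x ^^ p) y) = (bracket x ^^ p) (D y) + bracket ((bracket x ^^ (p - 1)) (D x)) y"
    by (subst derivation_bracket_pow) (simp_all add: leib x pow bracket_pow_sum_char[OF char_eq char_pos, simplified])
  moreover have "D (bracket (pmap x) y) = bracket (D (pmap x)) y + (bracket x ^^ p) (D y)"
    by (simp add: leib p_idealD(4)[OF J x] y) (simp add: bracket_pmap)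
  ultimately show ?thesis
    by (simp add: bracket_pmap bracket_diff_left)
qed

text \<open>Both \<open>ad x\<close> and \<open>D\<close> are moved past \<open>(ad y)\<^bsup>p-1\<^esup>\<close> by \<open>derivation_bracket_pow\<close>; the
  correction terms are those of \<open>bracket_pow_sum_symmetric\<close> with \<open>a = [x, y]\<close> and \<open>b = D y\<close>, and so they cancel.\<close>

lemma restricted_derivation_on_commutator:
  assumes J: "p_ideal J" and D: "restricted_derivation_on J D"
  shows "restricted_derivation_on J (\<lambda>y. bracket x (D y) - D (bracket x y))"
proof -
  have d: "derivation_on J D" and r: "\<And>y. y \<in> J \<Longrightarrow> D (pmap y) = (bracket y ^^ (p - 1)) (D y)"
    using D by (auto simp: restricted_derivation_on_def)
  note lin = linear_simps[OF derivation_onD(1)[OF d]]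
  note leib = derivation_onD(2)[OF d]
  let ?E = "\<lambda>y. bracket x (D y) - D (bracket x y)"
  have "Vector_Spaces.linear scale scale ?E"
    by (rule linearI) (simp_all add: lin bracket_linear_simps scale_right_diff_distrib)
  moreover have "?E (bracket y z) = bracket (?E y) z + bracket y (?E z)" if "y \<in> J" "z \<in> J" for y z
  proof -
    have "bracket x (D (bracket y z)) = bracket (bracket x (D y)) z + bracket (D y) (bracket x z)
        + (bracket (bracket x y) (D z) + bracket y (bracket x (D z)))"
      using that by (simp add: leib bracket_add_right bracket_leibniz[of x])
    moreover have "D (bracket x (bracket y z)) = bracket (D (bracket x y)) z + bracket (bracket x y) (D z)
        + (bracket (D y) (bracket x z) + bracket y (D (bracket x z)))"
      using that p_idealD(2)[OF J] by (simp add: bracket_leibniz[of x] lin leib)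
    ultimately show ?thesis by (simp add: bracket_linear_simps)
  qed
  moreover have "?E (pmap y) = (bracket y ^^ (p - 1)) (?E y)" if y: "y \<in> J" for y
  proof -
    have pow: "(bracket y ^^ k) (bracket x y) \<in> J" for k
      using bracket_pow_mem[of J y "bracket x y"] p_idealD(2)[OF J] y by blast
    have "bracket x (D (pmap y)) = (bracket y ^^ (p - 1)) (bracket x (D y))
        + (\<Sum>j<p - 1. (bracket y ^^ j) (bracket (bracket x y) ((bracket y ^^ (p - 1 - 1 - j)) (D y))))"
      unfolding r[OF y]
      by (rule derivation_bracket_pow[where E = "bracket x"]) (rule bracket_leibniz)
    also have "\<dots> = (bracket y ^^ (p - 1)) (bracket x (D y))
        + (\<Sum>j<p - 1. (bracket y ^^ j) (bracket (D y) ((bracket y ^^ (p - 1 - 1 - j)) (bracket x y))))"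
      by (subst bracket_pow_sum_symmetric[OF char_eq char_pos]) (rule refl)
    finally have *: "bracket x (D (pmap y)) = \<dots>" .
    have "D (bracket x (pmap y)) = (bracket y ^^ (p - 1)) (D (bracket x y))
        + (\<Sum>j<p - 1. (bracket y ^^ j) (bracket (D y) ((bracket y ^^ (p - 1 - 1 - j)) (bracket x y))))"
      unfolding bracket_pmap_right
      by (rule derivation_bracket_pow) (simp add: leib y pow)
    with * show ?thesis by (simp add: bracket_pow_diff)
  qed
  ultimately show ?thesis
    by (simp add: restricted_derivation_on_def derivation_on_def)
qed

text \<open>The first restricted cohomology of \<open>J\<close> with coefficients in \<open>L\<close> vanishes.\<close>

definition all_inner_on :: "'l set \<Rightarrow> bool" where
  "all_inner_on J \<longleftrightarrow> (\<forall>D. restricted_derivation_on J D \<longrightarrow> (\<exists>a. \<forall>y\<in>J. D y = bracket a y))"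

end

section \<open>Descent to a hyperplane of a p-ideal\<close>

text \<open>A \<open>p\<close>-ideal \<open>J\<close> with a hyperplane \<open>I\<close> that contains \<open>[L, J]\<close> and \<open>J\<^sup>[\<^sup>p\<^sup>]\<close>. The hyperplane is given as
  the zero set in \<open>J\<close> of a linear functional \<open>f\<close>, which also provides the coordinate of an element of \<open>J\<close>
  along the complement \<open>x\<close>.\<close>

locale p_ideal_hyperplane = restricted_lie_algebra +
  fixes J :: "'b set" and f :: "'b \<Rightarrow> 'a" and x :: 'b
  assumes J: "p_ideal J"
    and f_add: "f (y + z) = f y + f z"
    and f_scale: "f (c *s y) = c * f y"
    and f_bracket: "y \<in> J \<Longrightarrow> f (bracket z y) = 0"
    and f_pmap: "y \<in> J \<Longrightarrow> f (pmap y) = 0"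
    and x: "x \<in> J"
    and f_x: "f x = 1"
begin

definition I :: "'b set" where "I = {y \<in> J. f y = 0}"

lemma f_diff: "f (y - z) = f y - f z"
  using f_add[of "y - z" z] by simp

lemma f_zero: "f 0 = 0"
  using f_scale[of 0 0] by simp

lemma I_subset: "y \<in> I \<Longrightarrow> y \<in> J" and f_I: "y \<in> I \<Longrightarrow> f y = 0"
  by (auto simp: I_def)

lemma p_ideal_I: "p_ideal I"
  using p_idealD[OF J] f_bracket f_pmap
  by (auto simp: p_ideal_def I_def subspace_def f_add f_scale f_zero)

lemma bracket_in_I: "y \<in> J \<Longrightarrow> bracket z y \<in> I" and pmap_in_I: "y \<in> J \<Longrightarrow> pmap y \<in> I"
  using p_idealD[OF J] f_bracket f_pmap by (auto simp: I_def)

lemma decompose: "y \<in> J \<Longrightarrow> y - f y *s x \<in> I"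
  using x p_idealD(1)[OF J] by (auto simp: I_def f_diff f_scale f_x intro: subspace_diff subspace_scale)

text \<open>The linear map that agrees with \<open>\<delta>\<close> on \<open>I\<close> and sends \<open>x\<close> to \<open>m\<close>.\<close>

definition extend :: "('b \<Rightarrow> 'b) \<Rightarrow> 'b \<Rightarrow> 'b \<Rightarrow> 'b" where
  "extend \<delta> m y = \<delta> (y - f y *s x) + f y *s m"

context
  fixes \<delta> m
  assumes \<delta>: "derivation_on I \<delta>"
    and m: "\<And>i. i \<in> I \<Longrightarrow> \<delta> (bracket x i) = bracket m i + bracket x (\<delta> i)"
begin

lemmas \<delta>_lin = linear_simps[OF derivation_onD(1)[OF \<delta>]]

lemma extend_I: "i \<in> I \<Longrightarrow> extend \<delta> m i = \<delta> i"
  by (simp add: extend_def f_I)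

lemma extend_x: "extend \<delta> m x = m"
  by (simp add: extend_def f_x \<delta>_lin)

text \<open>The condition on \<open>m\<close> is the Leibniz rule for \<open>[x, i]\<close> with \<open>i \<in> I\<close>. Together with the rule on \<open>I\<close> it
  is enough, because brackets of elements of \<open>J\<close> lie in \<open>I\<close>, where the extension is \<open>\<delta>\<close>.\<close>

lemma derivation_on_extend: "derivation_on J (extend \<delta> m)"
proof -
  have "Vector_Spaces.linear scale scale (extend \<delta> m)"
    by (rule linearI) (simp_all add: extend_def f_add f_scale \<delta>_lin algebra_simps)
  moreover have "extend \<delta> m (bracket y z)
      = bracket (extend \<delta> m y) z + bracket y (extend \<delta> m z)" if "y \<in> J" "z \<in> J" for y z
  proof -
    define a i b k where "a = f y" and "i = y - f y *s x" and "b = f z" and "k = z - f z *s x"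
    have y: "y = a *s x + i" and z: "z = b *s x + k"
      by (simp_all add: a_def i_def b_def k_def)
    have i: "i \<in> I" and k: "k \<in> I" using decompose that by (simp_all add: i_def k_def)
    have ext: "extend \<delta> m y = \<delta> i + a *s m" "extend \<delta> m z = \<delta> k + b *s m"
      by (simp_all add: extend_def a_def i_def b_def k_def)
    have anti: "bracket i x = - bracket x i" "bracket (\<delta> i) x = - bracket x (\<delta> i)"
      "bracket m x = - bracket x m" "bracket i m = - bracket m i"
      by (rule bracket_anticomm)+
    have "bracket y z = a *s bracket x k - b *s bracket x i + bracket i k"
      unfolding y z by (simp add: bracket_linear_simps bracket_self anti algebra_simps)
    then have "extend \<delta> m (bracket y z)
        = \<delta> (a *s bracket x k - b *s bracket x i + bracket i k)"
      using extend_I[OF bracket_in_I[OF that(2), of y]] by simp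
    also have "\<dots> = a *s (bracket m k + bracket x (\<delta> k)) - b *s (bracket m i + bracket x (\<delta> i))
        + (bracket (\<delta> i) k + bracket i (\<delta> k))"
      by (simp add: \<delta>_lin m i k derivation_onD(2)[OF \<delta> i k])
    also have "\<dots> = bracket (\<delta> i + a *s m) (b *s x + k) + bracket (a *s x + i) (\<delta> k + b *s m)"
      by (simp add: bracket_linear_simps anti algebra_simps)
    finally show ?thesis unfolding ext y[symmetric] z[symmetric] .
  qed
  ultimately show ?thesis by (simp add: derivation_on_def)
qed

lemma restricted_derivation_on_extend:
  assumes "restricted_derivation_on I \<delta>" and "\<delta> (pmap x) = (bracket x ^^ (p - 1)) m"
  shows "restricted_derivation_on J (extend \<delta> m)"
proof -
  let ?D = "extend \<delta> m"
  have D: "derivation_on J ?D" by (rule derivation_on_extend)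
  have rx: "?D (pmap x) = (bracket x ^^ (p - 1)) (?D x)"
    using assms(2) by (simp add: extend_x extend_I pmap_in_I x)
  have ri: "?D (pmap i) = (bracket i ^^ (p - 1)) (?D i)" if "i \<in> I" for i
    using assms(1) that by (simp add: extend_I pmap_in_I I_subset restricted_derivation_on_def)
  have "?D (pmap y) = (bracket y ^^ (p - 1)) (?D y)" if "y \<in> J" for y
  proof -
    have "?D (pmap ((y - f y *s x) + f y *s x))
        = (bracket ((y - f y *s x) + f y *s x) ^^ (p - 1)) (?D ((y - f y *s x) + f y *s x))"
      using decompose[OF that] x p_idealD(1)[OF J]
      by (intro derivation_on_restricted_add[OF J D] derivation_on_restricted_scale[OF D] ri rx)
         (auto intro: I_subset subspace_scale)
    then show ?thesis by simp
  qed
  then show ?thesis using D by (simp add: restricted_derivation_on_def)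
qed

end

lemma centralizer_J: "centralizer J = {z \<in> centralizer I. bracket x z = 0}"
proof (intro equalityI subsetI)
  fix z assume "z \<in> {z \<in> centralizer I. bracket x z = 0}"
  then have z: "\<And>i. i \<in> I \<Longrightarrow> bracket i z = 0" "bracket x z = 0" by (auto simp: centralizer_def)
  have "bracket y z = 0" if "y \<in> J" for y
    using z(1)[OF decompose[OF that]] z(2) by (simp add: bracket_linear_simps)
  then show "z \<in> centralizer J" by (simp add: centralizer_def)
qed (use x I_subset in \<open>auto simp: centralizer_def\<close>)

lemma restricted_derivation_on_zero: "restricted_derivation_on K (\<lambda>_. 0)"
  by (auto simp: restricted_derivation_on_def derivation_on_def intro: linearI)

text \<open>The derivation that kills \<open>I\<close> and sends \<open>x\<close> to \<open>z\<close> is restricted, hence equal to some \<open>ad a\<close> on \<open>J\<close>.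
  Then \<open>a\<close> centralizes \<open>I\<close> and \<open>z = [a, x]\<close>.\<close>

lemma centralizer_I_divisible:
  assumes J_inner: "all_inner_on J" and z: "z \<in> centralizer I" and "(bracket x ^^ (p - 1)) z = 0"
  shows "\<exists>c\<in>centralizer I. z = bracket x c"
proof -
  have zero: "derivation_on I (\<lambda>_. 0)"
    using restricted_derivation_on_zero by (simp add: restricted_derivation_on_def)
  have hz: "0 = bracket z i + bracket x 0" if "i \<in> I" for i
    using centralizer_commute[OF z that] by simp
  have "restricted_derivation_on J (extend (\<lambda>_. 0) z)"
    using restricted_derivation_on_extend[OF zero hz restricted_derivation_on_zero] assms(3) by simp
  then obtain a where a: "\<And>y. y \<in> J \<Longrightarrow> extend (\<lambda>_. 0) z y = bracket a y"
    using J_inner unfolding all_inner_on_def by blast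
  have "bracket i (- a) = 0" if "i \<in> I" for i
    using a[OF I_subset[OF that]] bracket_anticomm[of a i] extend_I[OF zero hz that]
    by (simp add: bracket_minus_right)
  moreover have "z = bracket x (- a)"
    using a[OF x] bracket_anticomm[of a x] extend_x[OF zero hz]
    by (simp add: bracket_minus_right)
  ultimately show ?thesis by (auto simp: centralizer_def)
qed

text \<open>The same divisibility read at the other end: a vector in the kernel of \<open>ad x\<close> can be divided by \<open>ad x\<close>
  again and again, as long as the quotient is killed by \<open>(ad x)\<^bsup>p-1\<^esup>\<close>.\<close>

lemma centralizer_I_kernel:
  assumes J_inner: "all_inner_on J" and w: "w \<in> centralizer I" "bracket x w = 0"
  shows "\<exists>c\<in>centralizer I. w = (bracket x ^^ (p - 1)) c"
proof -
  have "\<exists>c\<in>centralizer I. w = (bracket x ^^ j) c" if "j \<le> p - 1" for j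
    using that
  proof (induction j)
    case 0
    then show ?case using w by auto
  next
    case (Suc j)
    then obtain c where c: "c \<in> centralizer I" "w = (bracket x ^^ j) c" by auto
    have "p - 1 = (p - 1 - Suc j) + Suc j" using Suc.prems by simp
    then have "(bracket x ^^ (p - 1)) c = (bracket x ^^ (p - 1 - Suc j)) ((bracket x ^^ Suc j) c)"
      using funpow_add[of "p - 1 - Suc j" "Suc j" "bracket x"] by (metis comp_apply)
    also have "(bracket x ^^ Suc j) c = 0" using c w by simp
    finally have "(bracket x ^^ (p - 1)) c = 0" by simp
    then obtain c' where "c' \<in> centralizer I" "c = bracket x c'"
      using centralizer_I_divisible[OF J_inner c(1)] by blast
    then show ?case using c by (auto simp: funpow_swap1)
  qed
  then show ?thesis by simp
qed

text \<open>If \<open>[ad x, \<delta>]\<close> equals \<open>ad a\<close> on \<open>I\<close>, then \<open>\<delta>\<close> extends to derivations of \<open>J\<close> that send \<open>x\<close> to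
  \<open>c - a\<close>, one for each \<open>c\<close> centralizing \<open>I\<close>. The failure \<open>w\<close> of the extension with \<open>c = 0\<close> to be
  restricted at \<open>x\<close> centralizes \<open>J\<close>, so \<open>centralizer_I_kernel\<close> provides a \<open>c\<close> that removes it.\<close>

lemma inner_on_I_if_commutator_inner:
  assumes J_inner: "all_inner_on J" and \<delta>: "restricted_derivation_on I \<delta>"
    and a: "\<And>i. i \<in> I \<Longrightarrow> bracket x (\<delta> i) - \<delta> (bracket x i) = bracket a i"
  shows "\<exists>b. \<forall>i\<in>I. \<delta> i = bracket b i"
proof -
  have d: "derivation_on I \<delta>" using \<delta> by (simp add: restricted_derivation_on_def)
  have m: "\<delta> (bracket x i) = bracket (- a) i + bracket x (\<delta> i)" if "i \<in> I" for i
    using a[OF that] by (simp add: bracket_minus_left algebra_simps)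
  define w where "w = \<delta> (pmap x) - (bracket x ^^ (p - 1)) (- a)"
  have "bracket w y = 0" if "y \<in> J" for y
    using derivation_on_defect_centralizes[OF J derivation_on_extend[OF d m] x that]
    by (simp add: extend_x[OF d m] extend_I[OF d m] pmap_in_I x w_def)
  then have "bracket y w = 0" if "y \<in> J" for y
    using that bracket_anticomm[of y w] by simp
  then have "w \<in> centralizer I" "bracket x w = 0"
    using I_subset x by (auto simp: centralizer_def)
  then obtain c where c: "c \<in> centralizer I" "w = (bracket x ^^ (p - 1)) c"
    using centralizer_I_kernel[OF J_inner] by blast
  have m': "\<delta> (bracket x i) = bracket (c - a) i + bracket x (\<delta> i)" if "i \<in> I" for i
    using m[OF that] centralizer_commute[OF c(1) that] by (simp add: bracket_linear_simps)
  have "\<delta> (pmap x) = (bracket x ^^ (p - 1)) (c - a)"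
    using c(2) by (simp add: w_def bracket_pow_minus bracket_pow_diff algebra_simps)
  then have "restricted_derivation_on J (extend \<delta> (c - a))"
    using restricted_derivation_on_extend[OF d m' \<delta>] by simp
  then obtain b where "\<And>y. y \<in> J \<Longrightarrow> extend \<delta> (c - a) y = bracket b y"
    using J_inner unfolding all_inner_on_def by blast
  then show ?thesis
    using extend_I[OF d m'] I_subset by metis
qed

text \<open>Choose \<open>c\<close> such that the lower central series \<open>L\<^sub>n\<close> vanishes at \<open>n = c\<close>. If \<open>\<delta>\<close> maps each \<open>L\<^sub>n\<close>
  into \<open>L\<^bsub>n+k-c\<^esub>\<close>, then \<open>[ad x, \<delta>]\<close> has this property for \<open>k + 1\<close>. Every linear \<open>\<delta>\<close> has it for
  \<open>k = 0\<close>, and for \<open>k = 2 c\<close> it forces \<open>\<delta> = 0\<close>; so downward induction on \<open>k\<close> applies. A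
  negative index \<open>n + k - c\<close> is truncated to \<open>0\<close>, which is harmless because \<open>L\<^sub>0\<close> is all of \<open>L\<close>.\<close>

lemma all_inner_on_I:
  assumes J_inner: "all_inner_on J" and nil: "nilpotent"
  shows "all_inner_on I"
proof -
  obtain c where c: "lower_central c = {0}" using nil by (auto simp: nilpotent_def)
  have lc0: "lower_central n = {0}" if "n \<ge> c" for n
    using lower_central_antimono[OF that] subspace_0[OF subspace_lower_central[of n]] c by auto
  have inner: "\<exists>b. \<forall>i\<in>I. \<delta> i = bracket b i"
    if "restricted_derivation_on I \<delta>"
      and "\<And>n y. y \<in> lower_central n \<Longrightarrow> \<delta> y \<in> lower_central (n + k - c)"
      and "k \<le> 2 * c" for k \<delta>
    using that(3,1,2)
  proof (induction k arbitrary: \<delta> rule: inc_induct)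
    case base
    have "\<delta> y = 0" for y
      using base.prems(2)[of y 0] lc0 by simp
    then show ?case by (intro exI[of _ 0]) simp
  next
    case (step k)
    let ?E = "\<lambda>y. bracket x (\<delta> y) - \<delta> (bracket x y)"
    have "?E y \<in> lower_central (n + Suc k - c)" if y: "y \<in> lower_central n" for n y
    proof (rule subspace_diff[OF subspace_lower_central])
      have "n + Suc k - c \<le> Suc (n + k - c)" by simp
      then show "bracket x (\<delta> y) \<in> lower_central (n + Suc k - c)"
        using bracket_lower_central[OF step.prems(2)[OF y]] lower_central_antimono by blast
      show "\<delta> (bracket x y) \<in> lower_central (n + Suc k - c)"
        using step.prems(2)[OF bracket_lower_central[OF y]] by simp
    qed
    then have "\<exists>a. \<forall>i\<in>I. ?E i = bracket a i"
      by (intro step.IH restricted_derivation_on_commutator[OF p_ideal_I step.prems(1)])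
    then show ?case
      using inner_on_I_if_commutator_inner[OF J_inner step.prems(1)] by blast
  qed
  show ?thesis
    unfolding all_inner_on_def
  proof (intro allI impI)
    fix \<delta> assume \<delta>: "restricted_derivation_on I \<delta>"
    then have "\<delta> 0 = 0"
      by (auto simp: restricted_derivation_on_def dest: derivation_onD(1) linear_simps(4))
    then have "\<delta> y \<in> lower_central (n + 0 - c)" if "y \<in> lower_central n" for n y
      using that lc0[of n] by (cases "n \<ge> c") (auto simp: subspace_0[OF subspace_lower_central])
    then show "\<exists>b. \<forall>i\<in>I. \<delta> i = bracket b i"
      using inner[OF \<delta>, of 0] by simp
  qed
qed

end

section \<open>Existence of hyperplanes and the center\<close>

context restricted_lie_algebra
begin

text \<open>A subspace of \<open>J\<close> between this one and \<open>J\<close> is automatically a \<open>p\<close>-ideal of \<open>L\<close>; these are the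
  candidates for the next term of the descent.\<close>

definition commutators_and_powers :: "'l set \<Rightarrow> 'l set" where
  "commutators_and_powers J = span ({bracket z y | z y. y \<in> J} \<union> pmap ` J)"

lemma hyperplane_exists:
  assumes J: "p_ideal J" and "\<not> J \<subseteq> commutators_and_powers J"
  obtains f x where "p_ideal_hyperplane scale bracket p pmap J f x"
proof -
  obtain x where x: "x \<in> J" "x \<notin> commutators_and_powers J" using assms by blast
  have "subspace (commutators_and_powers J)" by (simp add: commutators_and_powers_def)
  then obtain f where f: "\<And>y z. f (y + z) = f y + f z" "\<And>c y. f (c *s y) = c * f y"
    "f x = 1" "\<And>y. y \<in> commutators_and_powers J \<Longrightarrow> f y = 0"
    using x(2) by (rule separating_functional) blast
  have "bracket z y \<in> commutators_and_powers J" "pmap y \<in> commutators_and_powers J" if "y \<in> J" for y z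
    unfolding commutators_and_powers_def using that by (intro span_base; blast)+
  then have "p_ideal_hyperplane scale bracket p pmap J f x"
    by unfold_locales (simp_all add: J f x(1))
  then show ?thesis by (rule that)
qed

lemma bracket_pow_lower_central: "y \<in> lower_central n \<Longrightarrow> (bracket x ^^ k) y \<in> lower_central (n + k)"
  by (induction k) (auto intro: span_base)

text \<open>By induction on \<open>n\<close>, \<open>[L, J]\<close> lies in the \<open>n\<close>-th term of the lower central series: bracketing
  with a generator \<open>[z, y]\<close> gains one step, and \<open>[z, y\<^sup>[\<^sup>p\<^sup>]] = (ad y)\<^bsup>p-1\<^esup> [z, y]\<close> gains
  \<open>p - 1 \<ge> 1\<close> steps.\<close>

lemma central_if_subset_commutators_and_powers:
  assumes sub: "J \<subseteq> commutators_and_powers J" and nil: "nilpotent"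
  shows "J \<subseteq> centralizer UNIV"
proof -
  have "\<forall>z. \<forall>y\<in>J. bracket z y \<in> lower_central n" for n
  proof (induction n)
    case 0
    show ?case by simp
  next
    case (Suc n)
    have gen: "bracket z g \<in> lower_central (Suc n)"
      if "g \<in> {bracket z y | z y. y \<in> J} \<union> pmap ` J" for z g
      using that
    proof
      assume "g \<in> {bracket z y | z y. y \<in> J}"
      then show ?thesis using Suc bracket_lower_central by blast
    next
      assume "g \<in> pmap ` J"
      then obtain y where y: "y \<in> J" "g = pmap y" by blast
      have "(bracket y ^^ (p - 1)) (bracket z y) \<in> lower_central (n + (p - 1))"
        using Suc y by (intro bracket_pow_lower_central) blast
      moreover have "Suc n \<le> n + (p - 1)" using p_ge_2 by simp
      ultimately show ?thesis
        unfolding y bracket_pmap_right using lower_central_antimono by blast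
    qed
    have "bracket z y \<in> lower_central (Suc n)" if "y \<in> commutators_and_powers J" for z y
      using that[unfolded commutators_and_powers_def]
    proof (induction rule: span_induct)
      case base
      show ?case
        using subspace_lower_central[of "Suc n"]
        by (simp add: subspace_def bracket_add_right bracket_scale_right del: lower_central.simps)
    next
      case (step g)
      then show ?case by (rule gen)
    qed
    then show ?case using sub by blast
  qed
  moreover obtain n where "lower_central n = {0}" using nil by (auto simp: nilpotent_def)
  ultimately show ?thesis by (auto simp: centralizer_def)
qed

text \<open>The last nonzero term of the lower central series is central.\<close>

lemma nontrivial_center:
  assumes nil: "nilpotent" and "(z :: 'l) \<noteq> 0"
  shows "\<exists>w\<in>centralizer UNIV. w \<noteq> 0"
proof -
  obtain n where "lower_central n = {0}" using nil by (auto simp: nilpotent_def)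
  moreover have "lower_central 0 \<noteq> {0}"
  proof -
    have "z \<in> lower_central 0" by simp
    then show ?thesis using \<open>z \<noteq> 0\<close> by blast
  qed
  ultimately obtain k where k: "lower_central k \<noteq> {0}" "lower_central (Suc k) = {0}"
    using ex_least_nat_less[of "\<lambda>n. lower_central n = {0}" n] by blast
  then obtain w where "w \<in> lower_central k" "w \<noteq> 0"
    using subspace_0[OF subspace_lower_central[of k]] by blast
  moreover have "bracket y w = 0" if "w \<in> lower_central k" for y w
    using bracket_lower_central[OF that, of y] k by blast
  ultimately show ?thesis by (auto simp: centralizer_def)
qed

section \<open>Tori\<close>

lemma pmap_add_if_abelian:
  assumes "abelian"
  shows "pmap (x + y) = pmap x + pmap y"
proof -
  have "jacobson_s p i x y = 0" for i
  proof -
    obtain q where q: "p - 1 = Suc q" using p_ge_2 by (cases "p - 1") auto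
    have "poly_bracket f g = 0" for f g
      using assms by (simp add: poly_eq_iff coeff_poly_bracket abelian_def)
    then show ?thesis unfolding jacobson_s_def q by simp
  qed
  then show ?thesis by (simp add: pmap_add)
qed

end

locale finite_dimensional_restricted_lie_algebra =
  restricted_lie_algebra scale bracket p pmap + finite_dimensional_vector_space scale Basis
  for scale :: "'a::field \<Rightarrow> 'l::ab_group_add \<Rightarrow> 'l" (infixr \<open>*s\<close> 75)
    and bracket :: "'l \<Rightarrow> 'l \<Rightarrow> 'l" and p :: nat and pmap :: "'l \<Rightarrow> 'l" and Basis :: "'l set"
begin

text \<open>In the abelian case the \<open>p\<close>-mapping is semilinear, so the image of a basis spans whenever the whole image
  does, and a spanning set with at most \<open>dim L\<close> elements is a basis.\<close>

lemma pmap_independent: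
  assumes ab: "abelian" and span: "span (range pmap) = UNIV" and B: "independent B"
  shows "inj_on pmap B" "independent (pmap ` B)"
proof -
  obtain B' where B': "B \<subseteq> B'" "independent B'" "UNIV \<subseteq> span B'"
    by (rule maximal_independent_subset_extend[OF subset_UNIV B])
  have fin: "finite B'" using B'(2) by (rule finiteI_independent)
  have card: "dim UNIV = card B'" using dim_eq_card[of B' UNIV] B' by auto
  have zero: "pmap 0 = 0" using pmap_scale[of 0 0] char_pos by (simp add: zero_power)
  have "pmap y \<in> span (pmap ` B')" for y
  proof -
    have "y \<in> span B'" using B'(3) by blast
    then show ?thesis
    proof (induction rule: span_induct_alt)
      case base
      show ?case by (simp add: zero span_zero)
    next
      case (step c b z)
      then show ?case
        unfolding pmap_add_if_abelian[OF ab] pmap_scale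
        by (intro span_add span_scale) (simp_all add: span_base)
    qed
  qed
  then have "span (range pmap) \<subseteq> span (pmap ` B')"
    by (intro span_minimal subspace_span) blast
  then have sp: "UNIV \<subseteq> span (pmap ` B')" using span by simp
  have "card B' \<le> card (pmap ` B')"
    using dim_le_card[OF sp] fin card by simp
  then have eq: "card (pmap ` B') = card B'" using card_image_le[OF fin, of pmap] by simp
  then have "inj_on pmap B'" using fin by (intro eq_card_imp_inj_on)
  then show "inj_on pmap B" using B'(1) by (rule inj_on_subset)
  have "independent (pmap ` B')"
    using card_le_dim_spanning[of "pmap ` B'" UNIV] sp fin eq card by simp
  then show "independent (pmap ` B)" by (rule independent_mono) (use B'(1) in blast)
qed

text \<open>If \<open>P\<close> is a \<open>p\<close>-subalgebra that contains \<open>x\<^sup>[\<^sup>p\<^sup>]\<close>, the \<open>p\<close>-mapping sends \<open>P + F x\<close> into \<open>P\<close>.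
  It preserves linear independence, so \<open>P + F x\<close> is no larger than \<open>P\<close> and \<open>x \<in> P\<close>.\<close>

lemma torus_if_spanned_by_pmap:
  assumes ab: "abelian" and span: "span (range pmap) = UNIV"
  shows "torus"
  unfolding torus_def semisimple_def p_generated_def
proof (intro conjI allI ab)
  fix x
  have "x \<in> P" if P: "p_subalgebra P" "pmap x \<in> P" for P
  proof -
    have sub: "subspace P" and closed: "\<And>y. y \<in> P \<Longrightarrow> pmap y \<in> P"
      using P(1) by (auto simp: p_subalgebra_def lie_subalgebra_def)
    let ?Q = "span (insert x P)"
    have into: "pmap y \<in> P" if "y \<in> ?Q" for y
    proof -
      obtain k where "y - k *s x \<in> span P" using \<open>y \<in> ?Q\<close> span_breakdown_eq by blast
      then have "y - k *s x \<in> P" using sub span_eq_iff by blast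
      then have "pmap (y - k *s x) + pmap (k *s x) \<in> P"
        unfolding pmap_scale by (intro subspace_add[OF sub] subspace_scale[OF sub] closed P(2))
      then show ?thesis unfolding pmap_add_if_abelian[OF ab, symmetric] by simp
    qed
    obtain B where B: "B \<subseteq> ?Q" "independent B" "?Q \<subseteq> span B" "card B = dim ?Q"
      by (rule basis_exists)
    have "dim ?Q = card (pmap ` B)"
      using B(4) pmap_independent(1)[OF ab span B(2)] by (simp add: card_image)
    also have "\<dots> \<le> dim P"
      using into B(1) pmap_independent(2)[OF ab span B(2)] by (intro independent_card_le_dim) auto
    finally have "P = ?Q"
      by (intro subspace_dim_equal sub subspace_span) (auto intro: span_base)
    moreover have "x \<in> ?Q" by (rule span_base) simp
    ultimately show "x \<in> P" by simp
  qed
  then show "x \<in> p_subalgebra hull {pmap x}" by (auto simp: hull_def)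
qed

section \<open>The dimension count\<close>

lemma dim_centralizer_hyperplane:
  assumes "p_ideal_hyperplane scale bracket p pmap J f x" and "all_inner_on J"
  shows "p * dim (centralizer J) \<le> dim (centralizer (p_ideal_hyperplane.I J f))"
proof -
  interpret H: p_ideal_hyperplane scale bracket p pmap J f x by (rule assms(1))
  have "Vector_Spaces.linear scale scale (bracket x)"
    by (rule linearI) (simp_all add: bracket_add_right bracket_scale_right)
  then have "Suc (p - 1) * dim {z \<in> centralizer H.I. bracket x z = 0} \<le> dim (centralizer H.I)"
    by (rule dim_ge_of_divisible_kernel[OF _ subspace_centralizer])
       (use H.centralizer_I_divisible[OF assms(2)] in blast)+
  then show ?thesis using char_pos by (simp add: H.centralizer_J)
qed

text \<open>Each step of the descent from \<open>J\<close> lowers the dimension of the ideal by one and multiplies that of its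
  centralizer by at least \<open>p\<close>; \<open>n\<close> is the number of steps until the ideal is central.\<close>

lemma codimension_and_centralizer_growth:
  assumes nil: "nilpotent" and "p_ideal J" "all_inner_on J"
  shows "\<exists>n. dim J \<le> n + dim (centralizer UNIV) \<and> p ^ n * dim (centralizer J) \<le> dim UNIV"
  using assms(2,3)
proof (induction "dim J" arbitrary: J rule: less_induct)
  case less
  show ?case
  proof (cases "J \<subseteq> commutators_and_powers J")
    case True
    then have "J \<subseteq> centralizer UNIV"
      using central_if_subset_commutators_and_powers less.prems nil by blast
    then show ?thesis
      by (intro exI[of _ 0]) (auto intro: dim_subset simp del: dim_UNIV)
  next
    case False
    then obtain f x where "p_ideal_hyperplane scale bracket p pmap J f x"
      using hyperplane_exists less.prems(1) by blast
    then interpret H: p_ideal_hyperplane scale bracket p pmap J f x .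
    have subJ: "subspace J" and subI: "subspace H.I"
      using p_idealD(1) less.prems(1) H.p_ideal_I by auto
    have "dim H.I < dim J"
    proof -
      have "x \<notin> H.I" using H.f_x by (auto simp: H.I_def)
      then have "H.I \<subset> J" using H.I_subset H.x by blast
      moreover have "span H.I = H.I" "span J = J" using subJ subI span_eq_iff by blast+
      ultimately show ?thesis using dim_psubset by metis
    qed
    then obtain n where n: "dim H.I \<le> n + dim (centralizer UNIV)"
      "p ^ n * dim (centralizer H.I) \<le> dim UNIV"
      using less.hyps[OF _ H.p_ideal_I H.all_inner_on_I[OF less.prems(2) nil]] by blast
    have "J \<subseteq> span (insert x H.I)"
    proof
      fix y assume "y \<in> J"
      then have "y - f y *s x \<in> span H.I" using H.decompose span_base by blast
      then show "y \<in> span (insert x H.I)" using span_breakdown_eq by blast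
    qed
    then have "dim J \<le> dim (insert x H.I)" by (rule dim_mono)
    also have "\<dots> \<le> Suc (dim H.I)" by (simp add: dim_insert)
    finally have "dim J \<le> Suc n + dim (centralizer UNIV)" using n by simp
    moreover have "p * dim (centralizer J) \<le> dim (centralizer H.I)"
      using dim_centralizer_hyperplane less.prems(2) H.p_ideal_hyperplane_axioms by blast
    then have "p ^ n * (p * dim (centralizer J)) \<le> p ^ n * dim (centralizer H.I)" by simp
    then have "p ^ Suc n * dim (centralizer J) \<le> dim UNIV"
      using n(2) unfolding power_Suc2 mult.assoc by (rule order_trans)
    ultimately show ?thesis by blast
  qed
qed

text \<open>Such an \<open>L\<close> is spanned by its center and a single element.\<close>

lemma abelian_if_center_large:
  assumes "dim UNIV \<le> dim (centralizer UNIV) + 1"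
  shows "abelian"
proof (cases "centralizer UNIV = UNIV")
  case True
  then show ?thesis by (auto simp: abelian_def centralizer_def)
next
  case False
  then obtain x where x: "x \<notin> centralizer UNIV" by blast
  have span_center: "span (centralizer UNIV) = centralizer UNIV"
    using subspace_centralizer span_eq_iff by blast
  then have "dim (insert x (centralizer UNIV)) = dim (centralizer UNIV) + 1"
    using x by (subst dim_insert, subst span_center) simp
  then have "dim (insert x (centralizer UNIV)) = dim UNIV"
    using assms dim_subset[of "insert x (centralizer UNIV)" UNIV] by (simp del: dim_UNIV)
  then have "span (insert x (centralizer UNIV)) = UNIV"
    by (metis dim_eq_full dim_UNIV dimension_def)
  then have decompose: "\<exists>k. y - k *s x \<in> centralizer UNIV" for y
    using span_breakdown_eq[of y x "centralizer UNIV"] span_center by simp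
  have "bracket y z = 0" for y z
  proof -
    obtain k l where k: "y - k *s x \<in> centralizer UNIV" and l: "z - l *s x \<in> centralizer UNIV"
      using decompose by blast
    have "bracket y z = bracket (y - k *s x) z + k *s bracket x (z - l *s x)"
      by (simp add: bracket_linear_simps bracket_self)
    then show ?thesis using centralizer_commute[OF k] centralizer_commute[OF l] by simp
  qed
  then show ?thesis by (simp add: abelian_def)
qed

lemma p_ideal_UNIV: "p_ideal UNIV"
  by (simp add: p_ideal_def subspace_UNIV)

text \<open>Here the centralizers of \<open>L\<close> and of a hyperplane have the same dimension \<open>dim L\<close>, so a single step of the
  descent is contradictory.\<close>

lemma not_all_inner_if_abelian:
  assumes ab: "abelian" and "\<not> torus"
  shows "\<not> all_inner_on UNIV"
proof
  assume inner: "all_inner_on UNIV"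
  have "{bracket z y |z y. y \<in> UNIV} = {0}" using ab by (auto simp: abelian_def)
  then have "commutators_and_powers UNIV = span (range pmap)"
    by (simp add: commutators_and_powers_def)
  then have "\<not> UNIV \<subseteq> commutators_and_powers UNIV"
    using torus_if_spanned_by_pmap[OF ab] assms(2) by auto
  then obtain f x where H: "p_ideal_hyperplane scale bracket p pmap UNIV f x"
    using hyperplane_exists p_ideal_UNIV by blast
  then interpret H: p_ideal_hyperplane scale bracket p pmap UNIV f x .
  have "centralizer UNIV = UNIV" using ab by (auto simp: abelian_def centralizer_def)
  then have "p * dim UNIV \<le> dim (centralizer H.I)"
    using dim_centralizer_hyperplane[OF H inner] by metis
  also have "\<dots> \<le> dim UNIV" by (rule dim_subset) simp
  finally have "p * dim UNIV \<le> dim UNIV" .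
  moreover have "2 * dim UNIV \<le> p * dim UNIV" using p_ge_2 by (rule mult_le_mono1)
  ultimately have "dim UNIV = 0" by linarith
  then have "x = 0" using dim_eq_0[of UNIV] by (auto simp del: dim_UNIV)
  then show False using H.f_x H.f_zero by simp
qed

lemma not_all_inner:
  assumes nil: "nilpotent" and nt: "\<not> torus"
  shows "\<not> all_inner_on UNIV"
proof
  assume inner: "all_inner_on UNIV"
  let ?r = "dim (centralizer UNIV)"
  obtain n where n: "dim UNIV \<le> n + ?r" "p ^ n * ?r \<le> dim UNIV"
    using codimension_and_centralizer_growth[OF nil p_ideal_UNIV inner] by blast
  \<comment> \<open>From \<open>p\<^sup>n r \<le> n + r\<close>: two or more steps would make the left-hand side too large,
    since \<open>2\<^sup>n \<ge> n + 2\<close> for \<open>n \<ge> 2\<close>.\<close>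
  have "dim UNIV \<le> ?r + 1"
  proof (cases "?r = 0")
    case True
    then have "\<forall>w\<in>centralizer UNIV. w = 0" by auto
    then have "z = 0" for z :: 'l using nontrivial_center[OF nil, of z] by blast
    then have "UNIV \<subseteq> {0 :: 'l}" by blast
    then have "dim UNIV = 0" by (simp only: dim_eq_0)
    then show ?thesis by simp
  next
    case False
    have "2 ^ n * ?r \<le> p ^ n * ?r" using p_ge_2 by (intro mult_le_mono1 power_mono) auto
    then have le: "2 ^ n * ?r \<le> n + ?r" using n by linarith
    have "n \<le> 1"
    proof (rule ccontr)
      assume "\<not> n \<le> 1"
      then have "n + 2 \<le> 2 ^ n"
      proof (induction n)
        case (Suc n)
        then show ?case by (cases "n = 1") auto
      qed simp
      then have "(n + 2) * ?r \<le> n + ?r" using le mult_le_mono1[of "n + 2" "2 ^ n" ?r] by linarith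
      then have "n * ?r + ?r \<le> n" by (simp add: algebra_simps)
      moreover have "1 \<le> ?r" using False by linarith
      then have "n * 1 \<le> n * ?r" by (rule mult_le_mono2)
      ultimately show False using False by simp
    qed
    then show ?thesis using n by simp
  qed
  then have "abelian" by (rule abelian_if_center_large)
  then show False using not_all_inner_if_abelian nt inner by blast
qed

end

theorem theorem2:
  fixes scale :: "'a::field \<Rightarrow> 'l::ab_group_add \<Rightarrow> 'l"
    and bracket :: "'l \<Rightarrow> 'l \<Rightarrow> 'l" and p :: nat and pmap :: "'l \<Rightarrow> 'l"
  assumes "restricted_lie_algebra scale bracket p pmap"
    and "\<exists>B. finite_dimensional_vector_space scale B"
    and "lie_algebra.nilpotent scale bracket"
    and "\<not> restricted_lie_algebra.torus scale bracket pmap"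
  shows "\<exists>D. restricted_lie_algebra.outer_restricted_derivation scale bracket p pmap D"
proof -
  obtain B where B: "finite_dimensional_vector_space scale B" using assms(2) by blast
  interpret L: restricted_lie_algebra scale bracket p pmap by (rule assms(1))
  interpret L: finite_dimensional_restricted_lie_algebra scale bracket p pmap B
    using assms(1) B by (rule finite_dimensional_restricted_lie_algebra.intro)
  have "\<not> L.all_inner_on UNIV" using assms(3,4) by (rule L.not_all_inner)
  then obtain D where D: "L.restricted_derivation_on UNIV D" "\<And>a. D \<noteq> bracket a"
    by (auto simp: L.all_inner_on_def fun_eq_iff)
  then have "L.outer_restricted_derivation D"
    by (simp add: L.outer_restricted_derivation_def L.restricted_derivation_def L.derivation_def
        L.inner_derivation_def L.ad_def L.restricted_derivation_on_def L.derivation_on_def)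
  then show ?thesis by blast
qed

end
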